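(* Let $\{n_k\}_{k\in\mathbb{N}}$ be any sequence of integers such that $n_k\to\infty$ and $n_{k+1}-n_k\to\infty$ as $k\to\infty$. Let $\{V(n)\}_{n\in\mathbb{Z}}$ be independent random variables such that, if $n\notin\{n_k\}$, $V(n)$ equals $0$ or $1$ with probability $1/2$ each, and, if $n\in\{n_k\}$, $V(n)$ equals $0$ or $100$ with probability $1/2$ each. Let $H:\ell^2(\mathbb{Z})\to\ell^2(\mathbb{Z})$ be the discrete Schrödinger operator $[Hu](n)=u(n+1)+u(n-1)+V(n)u(n)$. Then the almost sure essential spectrum of $H$ is the union of the interval $[-2,3]$ and a Cantor set contained in the interval $[98,102]$.
   Context: The almost sure essential spectrum is the non-random set which almost surely coincides with the essential spectrum of $H$. A Cantor set is a nonempty compact, perfect, totally disconnected subset of $\mathbb{R}$. *)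

theory Defs
  imports "HOL-Probability.Probability" "HOL-Library.Function_Algebras"
begin

global_interpretation cseq: vector_space "\<lambda>(c::complex) (u::int \<Rightarrow> complex) n. c * u n"
  by standard (auto simp: fun_eq_iff algebra_simps)

definition l2 :: "(int \<Rightarrow> complex) set" where
  "l2 = {u. (\<lambda>n. (cmod (u n))\<^sup>2) summable_on UNIV}"

definition l2_norm :: "(int \<Rightarrow> complex) \<Rightarrow> real" where
  "l2_norm u = sqrt (\<Sum>\<^sub>\<infinity>n. (cmod (u n))\<^sup>2)"

lemma L2_set_le_l2_norm:
  assumes "u \<in> l2" "finite F"
  shows "L2_set (\<lambda>n. cmod (u n)) F \<le> l2_norm u"
  unfolding L2_set_def l2_norm_def
  by (rule real_sqrt_le_mono, rule finite_sum_le_infsum) (use assms in \<open>auto simp: l2_def\<close>)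

lemma l2_norm_bound:
  assumes "\<And>F. finite F \<Longrightarrow> L2_set (\<lambda>n. cmod (u n)) F \<le> B"
  shows "u \<in> l2" "l2_norm u \<le> B"
proof -
  have B0: "B \<ge> 0"
    using assms[of "{}"] by simp
  have le: "(\<Sum>n\<in>F. (cmod (u n))\<^sup>2) \<le> B\<^sup>2" if "finite F" for F
    using assms[OF that] unfolding L2_set_def by (rule sqrt_le_D)
  have s: "(\<lambda>n. (cmod (u n))\<^sup>2) summable_on UNIV"
    by (rule nonneg_bdd_above_summable_on) (auto intro!: bdd_aboveI[where M = "B\<^sup>2"] le)
  then show "u \<in> l2"
    by (simp add: l2_def)
  have "(\<Sum>\<^sub>\<infinity>n. (cmod (u n))\<^sup>2) \<le> B\<^sup>2"
    by (rule infsum_le_finite_sums[OF s]) (auto intro: le)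
  then show "l2_norm u \<le> B"
    unfolding l2_norm_def using B0 by (intro real_le_lsqrt) auto
qed

lemma l2_norm_nonneg: "0 \<le> l2_norm u"
  by (simp add: l2_norm_def infsum_nonneg)

lemma l2_add:
  assumes "u \<in> l2" "v \<in> l2"
  shows "u + v \<in> l2" "l2_norm (u + v) \<le> l2_norm u + l2_norm v"
proof -
  have "L2_set (\<lambda>n. cmod ((u + v) n)) F \<le> l2_norm u + l2_norm v" if F: "finite F" for F
  proof -
    have "L2_set (\<lambda>n. cmod ((u + v) n)) F \<le> L2_set (\<lambda>n. cmod (u n) + cmod (v n)) F"
      by (rule L2_set_mono) (auto intro: norm_triangle_ineq)
    also have "\<dots> \<le> L2_set (\<lambda>n. cmod (u n)) F + L2_set (\<lambda>n. cmod (v n)) F"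
      by (rule L2_set_triangle_ineq)
    also have "\<dots> \<le> l2_norm u + l2_norm v"
      using L2_set_le_l2_norm[OF assms(1) F] L2_set_le_l2_norm[OF assms(2) F] by simp
    finally show ?thesis .
  qed
  then show "u + v \<in> l2" "l2_norm (u + v) \<le> l2_norm u + l2_norm v"
    using l2_norm_bound[of "u + v" "l2_norm u + l2_norm v"] by auto
qed

lemma l2_mult_bounded:
  assumes "u \<in> l2" "\<And>n. cmod (a n) \<le> K"
  shows "(\<lambda>n. a n * u n) \<in> l2"
proof -
  have K: "K \<ge> 0"
    using assms(2)[of 0] norm_ge_zero order_trans by blast
  have "L2_set (\<lambda>n. cmod (a n * u n)) F \<le> K * l2_norm u" if F: "finite F" for F
  proof -
    have "L2_set (\<lambda>n. cmod (a n * u n)) F \<le> L2_set (\<lambda>n. K * cmod (u n)) F"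
      by (rule L2_set_mono) (auto simp: norm_mult intro: mult_right_mono assms(2))
    also have "\<dots> = K * L2_set (\<lambda>n. cmod (u n)) F"
      by (rule L2_set_right_distrib[OF K, symmetric])
    also have "\<dots> \<le> K * l2_norm u"
      by (rule mult_left_mono[OF L2_set_le_l2_norm[OF assms(1) F] K])
    finally show ?thesis .
  qed
  then show ?thesis
    by (rule l2_norm_bound(1))
qed

lemma l2_shift:
  assumes "u \<in> l2"
  shows "(\<lambda>n. u (n + k)) \<in> l2"
proof -
  have "bij_betw (\<lambda>n::int. n + k) UNIV UNIV"
    by (rule bij_betwI[where g = "\<lambda>n. n - k"]) auto
  from summable_on_reindex_bij_betw[OF this, of "\<lambda>n. (cmod (u n))\<^sup>2"] assms
  show ?thesis
    by (simp add: l2_def)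
qed

lemma subspace_l2: "cseq.subspace l2"
  unfolding cseq.subspace_def
proof (intro conjI ballI allI)
  show "0 \<in> l2"
    by (simp add: l2_def)
  show "u + v \<in> l2" if "u \<in> l2" "v \<in> l2" for u v
    using that by (rule l2_add)
  show "(\<lambda>n. c * u n) \<in> l2" if "u \<in> l2" for c u
    by (rule l2_mult_bounded[OF that order_refl])
qed

definition l2_dist :: "(int \<Rightarrow> complex) \<Rightarrow> (int \<Rightarrow> complex) \<Rightarrow> real" where
  "l2_dist u v = l2_norm (u - v)"

global_interpretation l2: Metric_space l2 l2_dist
proof
  show "0 \<le> l2_dist u v" for u v
    by (simp add: l2_dist_def l2_norm_nonneg)
  show "l2_dist u v = l2_dist v u" for u v
    by (simp add: l2_dist_def l2_norm_def norm_minus_commute)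
  show "l2_dist u v = 0 \<longleftrightarrow> u = v" if "u \<in> l2" "v \<in> l2" for u v
  proof
    assume "l2_dist u v = 0"
    have "u - v \<in> l2"
      using that by (rule cseq.subspace_diff[OF subspace_l2])
    from L2_set_le_l2_norm[OF this, of "{n}" for n] \<open>l2_dist u v = 0\<close>
    show "u = v"
      by (auto simp: l2_dist_def fun_eq_iff)
  qed (simp add: l2_dist_def l2_norm_def)
  show "l2_dist u w \<le> l2_dist u v + l2_dist v w"
    if "u \<in> l2" "v \<in> l2" "w \<in> l2" for u v w
    using l2_add(2)[of "u - v" "v - w"] that cseq.subspace_diff[OF subspace_l2]
    by (simp add: l2_dist_def)
qed

text \<open>
  Operators are given by functions on sequences, of which only the action on \<open>l2\<close> matters.
  For a bounded linear operator \<open>T\<close> on \<open>l2\<close>, the following are finite-dimensionality of the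
  kernel, closedness of the range and finite-dimensionality of the cokernel.
\<close>

definition l2_fredholm :: "((int \<Rightarrow> complex) \<Rightarrow> (int \<Rightarrow> complex)) \<Rightarrow> bool" where
  "l2_fredholm T \<longleftrightarrow>
     (\<exists>B. finite B \<and> {u \<in> l2. T u = 0} \<subseteq> cseq.span B) \<and>
     closedin l2.mtopology (T ` l2) \<and>
     (\<exists>B. finite B \<and> B \<subseteq> l2 \<and> (\<forall>f\<in>l2. \<exists>u\<in>l2. f - T u \<in> cseq.span B))"

text \<open>
  The Fredholm definition; for self-adjoint operators it agrees with the spectrum minus the
  isolated eigenvalues of finite multiplicity.
\<close>

definition essential_spectrum :: "((int \<Rightarrow> complex) \<Rightarrow> (int \<Rightarrow> complex)) \<Rightarrow> complex set" where
  "essential_spectrum T = {z. \<not> l2_fredholm (\<lambda>u. T u - (\<lambda>n. z * u n))}"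

definition schrodinger :: "(int \<Rightarrow> real) \<Rightarrow> (int \<Rightarrow> complex) \<Rightarrow> (int \<Rightarrow> complex)" where
  "schrodinger V u = (\<lambda>n. u (n + 1) + u (n - 1) + of_real (V n) * u n)"

lemma schrodinger_l2:
  assumes "u \<in> l2" "\<And>n. \<bar>V n\<bar> \<le> K"
  shows "schrodinger V u \<in> l2"
proof -
  have "schrodinger V u = (\<lambda>n. u (n + 1)) + (\<lambda>n. u (n + (-1))) + (\<lambda>n. of_real (V n) * u n)"
    by (simp add: schrodinger_def fun_eq_iff)
  moreover have "(\<lambda>n. of_real (V n) * u n) \<in> l2"
    by (rule l2_mult_bounded[OF assms(1), of _ K]) (simp add: assms(2))
  ultimately show ?thesis
    using l2_shift[OF assms(1), of 1] l2_shift[OF assms(1), of "-1"] by (auto intro!: l2_add(1))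
qed

definition as_essential_spectrum ::
  "'a measure \<Rightarrow> ('a \<Rightarrow> (int \<Rightarrow> complex) \<Rightarrow> (int \<Rightarrow> complex)) \<Rightarrow> complex set \<Rightarrow> bool" where
  "as_essential_spectrum M H S \<longleftrightarrow> (AE \<omega> in M. essential_spectrum (H \<omega>) = S)"

lemma (in prob_space) as_essential_spectrum_unique:
  assumes "as_essential_spectrum M H S" "as_essential_spectrum M H S'"
  shows "S = S'"
proof -
  have "AE \<omega> in M. S = S'"
    using assms unfolding as_essential_spectrum_def by eventually_elim simp
  then show ?thesis
    by simp
qed

text \<open>Perfect means closed (implied by compactness) and without isolated points.\<close>

definition cantor_set :: "real set \<Rightarrow> bool" where
  "cantor_set C \<longleftrightarrow>
     C \<noteq> {} \<and> compact C \<and> (\<forall>x\<in>C. x islimpt C) \<and>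
     (\<forall>x\<in>C. connected_component_set C x = {x})"

end

theory Submission
  imports Defs
begin

text \<open>
  It suffices to consider a fixed potential that realises, arbitrarily far out, every pattern which the
  distribution allows: almost every sample does so, by independence of disjoint blocks.

  Such patterns give approximate eigenfunctions with disjoint supports: truncated plane waves for
  \<open>[-2,2]\<close> and \<open>[-1,3]\<close>, truncated bound states of a single site with \<open>V = 100\<close> for the Cantor set. They
  prevent the range of \<open>H - z\<close> from being closed: otherwise every infinite combination of them, summed along
  different residue classes, would differ from an \<open>l2\<close> sequence by a solution of \<open>Hv = zv\<close>, and these
  solutions form a finite-dimensional space.

  Conversely, for the remaining \<open>z\<close> one has \<open>c \<parallel>u\<parallel> \<le> \<parallel>(H - z)u\<parallel>\<close> for all \<open>u\<close> supported far out, and this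
  implies the Fredholm property. For real \<open>z > 3\<close> a site with \<open>V = 100\<close> and \<open>0/1\<close> values \<open>x\<close> around it is
  governed by the scalar \<open>z - 100 - w\<^sub>+(z,x) - w\<^sub>-(z,x)\<close> with two continued fractions \<open>w\<^sub>\<plusminus>\<close>, up to errors
  exponentially small in the gaps. Its zero as a function of \<open>x\<close> depends on distant values exponentially
  weakly but strictly, so the set of zeros is a Cantor set.
\<close>

subsection \<open>Sequences in l2 as a Hilbert space\<close>

text \<open>The essential spectrum is defined through the Fredholm property, so both inclusions
  start from that definition: one refutes closedness of the range, the other uses a lower bound on a
  subspace of finite codimension and reads the cokernel off the formal adjoint
  \<open>jac V (cnj z)\<close>. The three-term recurrence keeps all solution spaces
  finite-dimensional. Total disconnectedness is a count. A window of radius k carries 2 * 4^k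
  patterns of 0 and 1, and a pattern fixes the eigenvalue up to 4 / 100^k, so these short intervals
  cannot cover an interval for large k. The height 100 of the barriers enters here: for z >= 98 the
  denominators of the continued fractions are at least 96. The obstacle above 3 is that a barrier
  also sees the other barriers. The continued fractions therefore use the potential with every 100
  replaced by 0, which keeps them in a compact family, and the other barriers become sources too far
  away to matter.\<close>

lemma l2_norm_L2: "u \<in> l2 \<Longrightarrow> (l2_norm u)\<^sup>2 = (\<Sum>\<^sub>\<infinity>n. (cmod (u n))\<^sup>2)"
  unfolding l2_norm_def by (simp add: infsum_nonneg)

lemma cmod_le_l2_norm: "u \<in> l2 \<Longrightarrow> cmod (u n) \<le> l2_norm u"
  using L2_set_le_l2_norm[of u "{n}"] by simp

lemma l2_diff: "u \<in> l2 \<Longrightarrow> v \<in> l2 \<Longrightarrow> u - v \<in> l2"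
  by (rule cseq.subspace_diff[OF subspace_l2])

lemma l2_scale: "u \<in> l2 \<Longrightarrow> (\<lambda>n. c * u n) \<in> l2"
  by (rule l2_mult_bounded) auto

lemma l2_inner_summable:
  assumes "u \<in> l2" "v \<in> l2"
  shows "(\<lambda>n. u n \<bullet> v n) summable_on UNIV"
proof -
  have "(\<lambda>n. (cmod (u n))\<^sup>2 + (cmod (v n))\<^sup>2) summable_on UNIV"
    using assms unfolding l2_def by (auto intro: summable_on_add)
  moreover have "norm (u n \<bullet> v n) \<le> (cmod (u n))\<^sup>2 + (cmod (v n))\<^sup>2" for n
  proof -
    have "\<bar>u n \<bullet> v n\<bar> \<le> cmod (u n) * cmod (v n)"
      by (rule Cauchy_Schwarz_ineq2)
    also have "\<dots> \<le> (cmod (u n))\<^sup>2 + (cmod (v n))\<^sup>2"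
    proof -
      have "0 \<le> (cmod (u n) - cmod (v n))\<^sup>2" "0 \<le> cmod (u n) * cmod (v n)" by auto
      then show ?thesis unfolding power2_diff by linarith
    qed
    finally show ?thesis by simp
  qed
  ultimately have "(\<lambda>n. norm (u n \<bullet> v n)) summable_on UNIV"
    by (rule Infinite_Sum.summable_on_comparison_test) auto
  then show ?thesis by (rule abs_summable_summable)
qed

text \<open>A type of its own gives access to the classes of inner product and Banach spaces. The
  structure is real: the inner product below is the real part of the complex one, and complex
  scalars are recovered by treating 1 and i separately.\<close>

typedef ell2 = l2
  by (rule exI[of _ 0]) (simp add: l2_def)

lemma ell2_eqI: "(\<And>n. Rep_ell2 u n = Rep_ell2 v n) \<Longrightarrow> u = v"
  by (simp add: Rep_ell2_inject[symmetric] fun_eq_iff)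

instantiation ell2 :: real_inner
begin

definition zero_ell2 :: ell2 where "0 = Abs_ell2 0"
definition plus_ell2 :: "ell2 \<Rightarrow> ell2 \<Rightarrow> ell2" where "u + v = Abs_ell2 (Rep_ell2 u + Rep_ell2 v)"
definition minus_ell2 :: "ell2 \<Rightarrow> ell2 \<Rightarrow> ell2" where "u - v = Abs_ell2 (Rep_ell2 u - Rep_ell2 v)"
definition uminus_ell2 :: "ell2 \<Rightarrow> ell2" where "- u = Abs_ell2 (- Rep_ell2 u)"
definition scaleR_ell2 :: "real \<Rightarrow> ell2 \<Rightarrow> ell2" where
  "r *\<^sub>R u = Abs_ell2 (\<lambda>n. complex_of_real r * Rep_ell2 u n)"
definition inner_ell2 :: "ell2 \<Rightarrow> ell2 \<Rightarrow> real" where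
  "u \<bullet> v = (\<Sum>\<^sub>\<infinity>n. Rep_ell2 u n \<bullet> Rep_ell2 v n)"
definition norm_ell2 :: "ell2 \<Rightarrow> real" where "norm u = l2_norm (Rep_ell2 u)"
definition dist_ell2_def: "dist (u::ell2) v = norm (u - v)"
definition sgn_ell2_def: "sgn (u::ell2) = inverse (norm u) *\<^sub>R u"
definition uniformity_ell2_def:
  "(uniformity :: (ell2 \<times> ell2) filter) = (INF e\<in>{0<..}. principal {(x, y). dist x y < e})"
definition open_ell2_def:
  "open (U :: ell2 set) \<longleftrightarrow> (\<forall>x\<in>U. \<forall>\<^sub>F (x', y) in uniformity. x' = x \<longrightarrow> y \<in> U)"

lemma Rep_zero_ell2: "Rep_ell2 0 = 0"
  unfolding zero_ell2_def by (rule Abs_ell2_inverse) (simp add: l2_def)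

lemma Rep_plus_ell2: "Rep_ell2 (u + v) = Rep_ell2 u + Rep_ell2 v"
  unfolding plus_ell2_def by (intro Abs_ell2_inverse l2_add Rep_ell2)

lemma Rep_minus_ell2: "Rep_ell2 (u - v) = Rep_ell2 u - Rep_ell2 v"
  unfolding minus_ell2_def by (intro Abs_ell2_inverse l2_diff Rep_ell2)

lemma Rep_uminus_ell2: "Rep_ell2 (- u) = - Rep_ell2 u"
  unfolding uminus_ell2_def
  by (intro Abs_ell2_inverse) (use cseq.subspace_neg[OF subspace_l2 Rep_ell2] in \<open>simp add: fun_Compl_def\<close>)

lemma Rep_scaleR_ell2: "Rep_ell2 (r *\<^sub>R u) = (\<lambda>n. complex_of_real r * Rep_ell2 u n)"
  unfolding scaleR_ell2_def by (intro Abs_ell2_inverse l2_scale Rep_ell2)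

lemmas Rep_ell2_simps = Rep_zero_ell2 Rep_plus_ell2 Rep_minus_ell2 Rep_uminus_ell2 Rep_scaleR_ell2

instance
proof
  fix u v w :: ell2 and r s :: real
  show "dist u v = norm (u - v)" by (simp add: dist_ell2_def)
  show "u + v + w = u + (v + w)" "u + v = v + u" "0 + u = u" "- u + u = 0" "u - v = u + - v"
    by (rule ell2_eqI, simp add: Rep_ell2_simps)+
  show "r *\<^sub>R (u + v) = r *\<^sub>R u + r *\<^sub>R v" "(r + s) *\<^sub>R u = r *\<^sub>R u + s *\<^sub>R u"
    "r *\<^sub>R s *\<^sub>R u = (r * s) *\<^sub>R u" "1 *\<^sub>R u = u"
    by (rule ell2_eqI, simp add: Rep_ell2_simps distrib_left distrib_right)+
  show "sgn u = inverse (norm u) *\<^sub>R u" by (simp add: sgn_ell2_def)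
  show "uniformity = (INF e\<in>{0<..}. principal {(x, y::ell2). dist x y < e})"
    by (rule uniformity_ell2_def)
  show "open U \<longleftrightarrow> (\<forall>x\<in>U. \<forall>\<^sub>F (x', y) in uniformity. x' = x \<longrightarrow> y \<in> U)" for U :: "ell2 set"
    by (rule open_ell2_def)
  show "u \<bullet> v = v \<bullet> u" by (simp add: inner_ell2_def inner_commute)
  show "(u + v) \<bullet> w = u \<bullet> w + v \<bullet> w"
    unfolding inner_ell2_def Rep_ell2_simps plus_fun_def inner_add_left
    by (rule infsum_add) (intro l2_inner_summable Rep_ell2)+
  show "r *\<^sub>R u \<bullet> v = r * (u \<bullet> v)"
    unfolding inner_ell2_def Rep_ell2_simps scaleR_conv_of_real[symmetric] inner_scaleR_left
    by (rule infsum_cmult_right')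
  have sq: "u \<bullet> u = (norm u)\<^sup>2"
    unfolding norm_ell2_def l2_norm_L2[OF Rep_ell2] inner_ell2_def by (simp add: power2_norm_eq_inner)
  then show "0 \<le> u \<bullet> u" by simp
  show "norm u = sqrt (u \<bullet> u)" using sq by (simp add: norm_ell2_def l2_norm_nonneg)
  show "u \<bullet> u = 0 \<longleftrightarrow> u = 0"
  proof
    assume "u \<bullet> u = 0"
    then have "l2_norm (Rep_ell2 u) = 0" using sq by (simp add: norm_ell2_def)
    then have "Rep_ell2 u n = 0" for n
      using cmod_le_l2_norm[OF Rep_ell2, of u n] by simp
    then show "u = 0" by (intro ell2_eqI) (simp add: Rep_ell2_simps)
  next
    assume "u = 0"
    then show "u \<bullet> u = 0" by (simp add: inner_ell2_def Rep_ell2_simps)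
  qed
qed

end

lemma cmod_Rep_ell2_le: "cmod (Rep_ell2 u n) \<le> norm u"
  unfolding norm_ell2_def by (rule cmod_le_l2_norm[OF Rep_ell2])

instance ell2 :: complete_space
proof
  fix X :: "nat \<Rightarrow> ell2"
  assume X: "Cauchy X"
  have "Cauchy (\<lambda>k. Rep_ell2 (X k) n)" for n
  proof (rule metric_CauchyI)
    fix e :: real assume "e > 0"
    with X obtain K where K: "\<forall>k\<ge>K. \<forall>m\<ge>K. dist (X k) (X m) < e" by (auto simp: Cauchy_def)
    have "dist (Rep_ell2 (X k) n) (Rep_ell2 (X m) n) < e" if "k \<ge> K" "m \<ge> K" for k m
      using K that cmod_Rep_ell2_le[of "X k - X m" n]
      by (force simp: dist_norm Rep_ell2_simps)
    then show "\<exists>M. \<forall>m\<ge>M. \<forall>k\<ge>M. dist (Rep_ell2 (X m) n) (Rep_ell2 (X k) n) < e" by blast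
  qed
  then have "\<exists>l. (\<lambda>k. Rep_ell2 (X k) n) \<longlonglongrightarrow> l" for n
    by (simp add: Cauchy_convergent_iff convergent_def)
  then obtain x where x: "\<And>n. (\<lambda>k. Rep_ell2 (X k) n) \<longlonglongrightarrow> x n" by metis
  \<comment> \<open>The Cauchy estimate on a finite set of sites passes to the pointwise limit
    \<open>x\<close>, and \<open>l2_norm_bound\<close> turns these uniform finite estimates into one
    in \<open>l2\<close>.\<close>
  have lim: "\<exists>K. \<forall>k\<ge>K. Rep_ell2 (X k) - x \<in> l2 \<and> l2_norm (Rep_ell2 (X k) - x) \<le> e" if "e > 0" for e
  proof -
    from X \<open>e > 0\<close> obtain K where K: "\<forall>k\<ge>K. \<forall>m\<ge>K. dist (X k) (X m) < e" by (auto simp: Cauchy_def)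
    have "L2_set (\<lambda>n. cmod ((Rep_ell2 (X k) - x) n)) F \<le> e" if "k \<ge> K" "finite F" for k F
    proof (rule LIMSEQ_le_const2)
      show "(\<lambda>m. L2_set (\<lambda>n. cmod (Rep_ell2 (X k) n - Rep_ell2 (X m) n)) F)
        \<longlonglongrightarrow> L2_set (\<lambda>n. cmod ((Rep_ell2 (X k) - x) n)) F"
        unfolding L2_set_def minus_apply
        by (intro tendsto_real_sqrt tendsto_sum tendsto_power tendsto_norm tendsto_diff x tendsto_const)
      have "L2_set (\<lambda>n. cmod (Rep_ell2 (X k) n - Rep_ell2 (X m) n)) F \<le> e" if "m \<ge> K" for m
        using L2_set_le_l2_norm[OF Rep_ell2 \<open>finite F\<close>, of "X k - X m"] K that \<open>k \<ge> K\<close>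
        by (force simp: dist_norm Rep_ell2_simps norm_ell2_def)
      then show "\<exists>N. \<forall>m\<ge>N. L2_set (\<lambda>n. cmod (Rep_ell2 (X k) n - Rep_ell2 (X m) n)) F \<le> e" by blast
    qed
    then have "Rep_ell2 (X k) - x \<in> l2 \<and> l2_norm (Rep_ell2 (X k) - x) \<le> e" if "k \<ge> K" for k
      using l2_norm_bound[of "Rep_ell2 (X k) - x" e] that by blast
    then show ?thesis by blast
  qed
  from lim[of 1] obtain k where "Rep_ell2 (X k) - x \<in> l2" by auto
  from l2_diff[OF Rep_ell2[of "X k"] this] have xl2: "x \<in> l2" by simp
  have "X \<longlonglongrightarrow> Abs_ell2 x"
  proof (rule metric_LIMSEQ_I)
    fix e :: real assume "e > 0"
    with lim[of "e/2"] obtain K where "\<forall>k\<ge>K. l2_norm (Rep_ell2 (X k) - x) \<le> e/2" by auto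
    then show "\<exists>K. \<forall>k\<ge>K. dist (X k) (Abs_ell2 x) < e" using \<open>e > 0\<close>
      by (intro exI[of _ K]) (force simp: dist_norm Rep_ell2_simps norm_ell2_def Abs_ell2_inverse[OF xl2])
  qed
  then show "convergent X" by (auto simp: convergent_def)
qed

instance ell2 :: banach ..

text \<open>If \<open>b\<close> lies outside \<open>Y\<close>, it has a positive distance
  \<open>d\<close> from it, and the coefficient of \<open>b\<close> is at most the norm of the sum
  divided by \<open>d\<close>. Convergent sums therefore have convergent coefficients.\<close>

lemma closed_plus_line:
  fixes Y :: "'a::{real_normed_vector, complete_space} set"
  assumes "closed Y" "subspace Y"
  shows "closed {y + t *\<^sub>R b | y t. y \<in> Y}"
proof (cases "b \<in> Y")
  case True
  have "{y + t *\<^sub>R b | y t. y \<in> Y} = Y"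
  proof (intro equalityI subsetI)
    show "x \<in> Y" if "x \<in> {y + t *\<^sub>R b | y t. y \<in> Y}" for x
      using that True \<open>subspace Y\<close> by (auto intro!: subspace_add subspace_scale)
    show "x \<in> {y + t *\<^sub>R b | y t. y \<in> Y}" if "x \<in> Y" for x
      using that by (intro CollectI exI[of _ x] exI[of _ 0]) auto
  qed
  then show ?thesis using \<open>closed Y\<close> by simp
next
  case False
  moreover have "open (- Y)" using \<open>closed Y\<close> by (simp add: open_Compl)
  ultimately obtain d where "d > 0" "ball b d \<subseteq> - Y"
    by (meson ComplI open_contains_ball)
  then have d: "d > 0" "\<And>y. y \<in> Y \<Longrightarrow> d \<le> dist b y"
    by (auto simp: ball_def not_less[symmetric])
  have ineq: "d * \<bar>t\<bar> \<le> norm (y + t *\<^sub>R b)" if "y \<in> Y" for y t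
  proof (cases "t = 0")
    case False
    have "(- 1 / t) *\<^sub>R y \<in> Y" using that \<open>subspace Y\<close> by (intro subspace_scale)
    from d(2)[OF this] have "d \<le> norm ((1/t) *\<^sub>R (y + t *\<^sub>R b))"
      using False by (simp add: dist_norm algebra_simps)
    also have "\<dots> = norm (y + t *\<^sub>R b) / \<bar>t\<bar>" by simp
    finally show ?thesis using False by (simp add: field_simps)
  qed auto
  show ?thesis
    unfolding closed_sequential_limits
  proof safe
    fix X l assume X: "\<forall>n. X n \<in> {y + t *\<^sub>R b | y t. y \<in> Y}" "X \<longlonglongrightarrow> l"
    from X(1) have "\<forall>n. \<exists>y t. X n = y + t *\<^sub>R b \<and> y \<in> Y" by blast
    then obtain y t where yt: "\<And>n. y n \<in> Y" "\<And>n. X n = y n + t n *\<^sub>R b" by metis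
    have "Cauchy t"
    proof (rule metric_CauchyI)
      fix e :: real assume "e > 0"
      from LIMSEQ_imp_Cauchy[OF X(2)] \<open>d > 0\<close> \<open>e > 0\<close> obtain K
        where K: "\<forall>m\<ge>K. \<forall>n\<ge>K. dist (X m) (X n) < d * e" by (meson Cauchy_def mult_pos_pos)
      have "dist (t m) (t n) < e" if "m \<ge> K" "n \<ge> K" for m n
      proof -
        have "y m - y n \<in> Y" using yt \<open>subspace Y\<close> by (auto intro: subspace_diff)
        from ineq[OF this, of "t m - t n"] have "d * \<bar>t m - t n\<bar> \<le> dist (X m) (X n)"
          by (simp add: yt dist_norm algebra_simps)
        also have "\<dots> < d * e" using K that by blast
        finally show ?thesis using \<open>d > 0\<close> by (simp add: dist_real_def)
      qed
      then show "\<exists>M. \<forall>m\<ge>M. \<forall>n\<ge>M. dist (t m) (t n) < e" by blast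
    qed
    then obtain t0 where t0: "t \<longlonglongrightarrow> t0" by (auto simp: Cauchy_convergent_iff convergent_def)
    have "(\<lambda>n. X n - t n *\<^sub>R b) \<longlonglongrightarrow> l - t0 *\<^sub>R b"
      by (intro tendsto_intros X t0)
    then have "l - t0 *\<^sub>R b \<in> Y"
      using \<open>closed Y\<close> yt by (auto simp: closed_sequential_limits)
    then show "\<exists>y t. l = y + t *\<^sub>R b \<and> y \<in> Y"
      by (intro exI[of _ "l - t0 *\<^sub>R b"] exI[of _ t0]) auto
  qed
qed

text \<open>The parallelogram law makes a minimising sequence for the distance to \<open>f\<close>
  Cauchy; vanishing of the first variation at its limit is the orthogonality.\<close>

lemma orthogonal_projection_exists:
  fixes Y :: "'a::{real_inner, complete_space} set"
  assumes Y: "closed Y" "subspace Y"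
  obtains y where "y \<in> Y" "\<And>v. v \<in> Y \<Longrightarrow> (f - y) \<bullet> v = 0"
proof -
  define d where "d = (INF y\<in>Y. (norm (f - y))\<^sup>2)"
  have Yne: "Y \<noteq> {}" using Y subspace_0 by auto
  have bdd: "bdd_below ((\<lambda>y. (norm (f - y))\<^sup>2) ` Y)" by (rule bdd_belowI[of _ 0]) auto
  have d_le: "d \<le> (norm (f - y))\<^sup>2" if "y \<in> Y" for y
    unfolding d_def by (rule cINF_lower[OF bdd that])
  have "\<exists>y\<in>Y. (norm (f - y))\<^sup>2 < d + 1 / Suc k" for k
    using cInf_lessD[of "(\<lambda>y. (norm (f - y))\<^sup>2) ` Y" "d + 1 / Suc k"] Yne unfolding d_def by fastforce
  then obtain y where y: "\<And>k. y k \<in> Y" "\<And>k. (norm (f - y k))\<^sup>2 < d + 1 / Suc k" by metis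
  have par: "(norm (y j - y k))\<^sup>2 \<le> 2 / Suc j + 2 / Suc k" for j k
  proof -
    have "(1/2) *\<^sub>R (y j + y k) \<in> Y" using y Y by (intro subspace_scale subspace_add)
    from d_le[OF this] have "4 * d \<le> 4 * (norm (f - (1/2) *\<^sub>R (y j + y k)))\<^sup>2" by simp
    also have "\<dots> = (norm (2 *\<^sub>R (f - (1/2) *\<^sub>R (y j + y k))))\<^sup>2" by (simp add: power_mult_distrib)
    also have "2 *\<^sub>R (f - (1/2) *\<^sub>R (y j + y k)) = (f - y j) + (f - y k)"
      by (simp add: algebra_simps scaleR_2)
    finally have 1: "4 * d \<le> (norm ((f - y j) + (f - y k)))\<^sup>2" .
    have "(norm (y j - y k))\<^sup>2 = (norm ((f - y j) - (f - y k)))\<^sup>2" by (simp add: norm_minus_commute)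
    also have "\<dots> = 2 * (norm (f - y j))\<^sup>2 + 2 * (norm (f - y k))\<^sup>2 - (norm ((f - y j) + (f - y k)))\<^sup>2"
      unfolding power2_norm_eq_inner by (simp add: inner_diff_left inner_diff_right inner_add_left inner_add_right inner_commute)
    finally show ?thesis using 1 y(2)[of j] y(2)[of k] by linarith
  qed
  have "Cauchy y"
  proof (rule metric_CauchyI)
    fix e :: real assume "e > 0"
    then obtain K where K: "K > 0" "inverse (real K) < e\<^sup>2 / 4" using ex_inverse_of_nat_less[of "e\<^sup>2/4"] by auto
    have "dist (y j) (y k) < e" if "j \<ge> K" "k \<ge> K" for j k
    proof -
      have "2 / real (Suc j) + 2 / real (Suc k) \<le> 2 / real K + 2 / real K"
        using that K(1) by (intro add_mono divide_left_mono) auto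
      also have "\<dots> < e\<^sup>2" using K(2) by (simp add: inverse_eq_divide)
      finally have "(norm (y j - y k))\<^sup>2 < e\<^sup>2" using par[of j k] by linarith
      then show ?thesis using \<open>e > 0\<close> by (simp add: dist_norm power_less_imp_less_base)
    qed
    then show "\<exists>M. \<forall>m\<ge>M. \<forall>n\<ge>M. dist (y m) (y n) < e" by blast
  qed
  then obtain y0 where y0: "y \<longlonglongrightarrow> y0" by (auto simp: Cauchy_convergent_iff convergent_def)
  have "y0 \<in> Y" using y0 y Y by (auto simp: closed_sequential_limits)
  have "(norm (f - y0))\<^sup>2 \<le> d"
  proof (rule LIMSEQ_le)
    show "(\<lambda>k. (norm (f - y k))\<^sup>2) \<longlonglongrightarrow> (norm (f - y0))\<^sup>2" by (intro tendsto_intros y0)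
    have "(\<lambda>k. d + inverse (real (Suc k))) \<longlonglongrightarrow> d + 0" by (intro tendsto_intros LIMSEQ_inverse_real_of_nat)
    then show "(\<lambda>k. d + 1 / real (Suc k)) \<longlonglongrightarrow> d" by (simp add: inverse_eq_divide)
    show "\<exists>N. \<forall>n\<ge>N. (norm (f - y n))\<^sup>2 \<le> d + 1 / real (Suc n)" using y(2) less_imp_le by blast
  qed
  then have min: "(norm (f - y0))\<^sup>2 \<le> (norm (f - v))\<^sup>2" if "v \<in> Y" for v
    using d_le[OF that] by linarith
  have "(f - y0) \<bullet> v = 0" if "v \<in> Y" for v
  proof -
    let ?s = "(f - y0) \<bullet> v"
    have q: "0 \<le> t\<^sup>2 * (norm v)\<^sup>2 - 2 * t * ?s" for t
    proof -
      have "y0 + t *\<^sub>R v \<in> Y" using \<open>y0 \<in> Y\<close> that Y by (intro subspace_scale subspace_add)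
      from min[OF this] have "(norm (f - y0))\<^sup>2 \<le> (norm ((f - y0) - t *\<^sub>R v))\<^sup>2" by (simp add: diff_diff_eq)
      also have "\<dots> = (norm (f - y0))\<^sup>2 + t\<^sup>2 * (norm v)\<^sup>2 - 2 * t * ?s"
        unfolding power2_norm_eq_inner
        by (simp add: inner_diff_left inner_diff_right inner_commute power2_eq_square algebra_simps)
      finally show ?thesis by simp
    qed
    show ?thesis
    proof (cases "v = 0")
      case False
      then have nv: "(norm v)\<^sup>2 > 0" by simp
      have eq: "(x / a)\<^sup>2 * a - 2 * (x / a) * x = - (x\<^sup>2 / a)" if "a > 0" for x a :: real
        using that by (simp add: field_simps power2_eq_square)
      \<comment> \<open>This \<open>t\<close> minimises the quadratic in \<open>q\<close>; its value
        there is - s^2 / |v|^2, which is nonnegative only for s = 0.\<close>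
      from q[of "?s / (norm v)\<^sup>2"] have "?s\<^sup>2 / (norm v)\<^sup>2 \<le> 0"
        unfolding eq[OF nv] by simp
      then have "?s\<^sup>2 \<le> 0" using nv by (simp add: divide_le_0_iff)
      then show ?thesis by simp
    qed auto
  qed
  with \<open>y0 \<in> Y\<close> show ?thesis by (rule that)
qed

subsection \<open>Fredholm property from a lower bound at infinity\<close>

text \<open>The form in which pointwise estimates enter. Four terms are the most that a later
  estimate has; shorter ones are padded with coefficient 0.\<close>

lemma l2_dominated:
  assumes "g1 \<in> l2" "g2 \<in> l2" "g3 \<in> l2" "g4 \<in> l2" "a \<ge> 0" "b \<ge> 0" "c \<ge> 0" "d \<ge> 0"
    "\<And>n. cmod (f n) \<le> a * cmod (g1 n) + b * cmod (g2 n) + c * cmod (g3 n) + d * cmod (g4 n)"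
  shows "f \<in> l2" "l2_norm f \<le> a * l2_norm g1 + b * l2_norm g2 + c * l2_norm g3 + d * l2_norm g4"
proof -
  have "L2_set (\<lambda>n. cmod (f n)) F \<le> a * l2_norm g1 + b * l2_norm g2 + c * l2_norm g3 + d * l2_norm g4"
    if F: "finite F" for F
  proof -
    let ?L = "\<lambda>g. L2_set (\<lambda>n. cmod (g n)) F"
    have "?L f \<le> L2_set (\<lambda>n. a * cmod (g1 n) + b * cmod (g2 n) + c * cmod (g3 n) + d * cmod (g4 n)) F"
      by (rule L2_set_mono) (auto intro: assms)
    also have "\<dots> \<le> L2_set (\<lambda>n. a * cmod (g1 n)) F + L2_set (\<lambda>n. b * cmod (g2 n)) F
        + L2_set (\<lambda>n. c * cmod (g3 n)) F + L2_set (\<lambda>n. d * cmod (g4 n)) F"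
      by (intro order_trans[OF L2_set_triangle_ineq] add_mono order_refl)
    also have "\<dots> = a * ?L g1 + b * ?L g2 + c * ?L g3 + d * ?L g4"
      using assms by (simp add: L2_set_right_distrib)
    also have "\<dots> \<le> a * l2_norm g1 + b * l2_norm g2 + c * l2_norm g3 + d * l2_norm g4"
      by (intro add_mono mult_left_mono L2_set_le_l2_norm assms F)
    finally show ?thesis .
  qed
  from l2_norm_bound[of f, OF this] show "f \<in> l2"
    "l2_norm f \<le> a * l2_norm g1 + b * l2_norm g2 + c * l2_norm g3 + d * l2_norm g4" by blast+
qed

lemma zero_in_l2: "0 \<in> l2"
  by (simp add: l2_def)

lemma l2_norm_mono:
  assumes "g \<in> l2" "\<And>n. cmod (f n) \<le> cmod (g n)"
  shows "f \<in> l2" "l2_norm f \<le> l2_norm g"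
  using l2_dominated[OF assms(1) zero_in_l2 zero_in_l2 zero_in_l2, of 1 0 0 0 f] assms(2) by auto

lemma l2_norm_shift: "l2_norm (\<lambda>n. u (n + k)) = l2_norm u"
proof -
  have "bij_betw (\<lambda>n::int. n + k) UNIV UNIV"
    by (rule bij_betwI[where g = "\<lambda>n. n - k"]) auto
  from infsum_reindex_bij_betw[OF this, of "\<lambda>n. (cmod (u n))\<^sup>2"] show ?thesis
    by (simp add: l2_norm_def)
qed

lemma l2_norm_scale: "l2_norm (\<lambda>n. c * u n) = cmod c * l2_norm u"
  by (simp add: l2_norm_def norm_mult power_mult_distrib infsum_cmult_right' real_sqrt_mult)

lemma finite_support_l2:
  assumes "finite {n. u n \<noteq> 0}"
  shows "u \<in> l2"
proof -
  have "(\<lambda>n. (cmod (u n))\<^sup>2) summable_on {n. u n \<noteq> 0}"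
    using assms by (rule summable_on_finite)
  also have "?this \<longleftrightarrow> (\<lambda>n. (cmod (u n))\<^sup>2) summable_on UNIV"
    by (rule summable_on_cong_neutral) auto
  finally show ?thesis by (simp add: l2_def)
qed

text \<open>Evaluation on \<open>I\<close> is injective on \<open>W\<close>. Passing to the kernel
  of one evaluation costs at most one basis vector, so at most as many are needed as
  \<open>I\<close> has elements.\<close>

lemma finite_basis_of_determining_coordinates:
  assumes "finite I" "cseq.subspace W" "\<And>g. g \<in> W \<Longrightarrow> \<forall>i\<in>I. g i = 0 \<Longrightarrow> g = 0"
  shows "\<exists>B. finite B \<and> B \<subseteq> W \<and> W \<subseteq> cseq.span B"
  using assms
proof (induction I arbitrary: W)
  case empty
  then have "W \<subseteq> {0}" by blast
  then show ?case by (intro exI[of _ "{}"]) (simp add: cseq.span_empty)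
next
  case (insert i I)
  let ?W' = "{g \<in> W. g i = 0}"
  have "cseq.subspace ?W'"
    using insert.prems(1) by (auto simp: cseq.subspace_def)
  then obtain B where B: "finite B" "B \<subseteq> ?W'" "?W' \<subseteq> cseq.span B"
    using insert.IH[of ?W'] insert.prems(2) by (metis (mono_tags, lifting) insert_iff mem_Collect_eq)
  show ?case
  proof (cases "W \<subseteq> ?W'")
    case True
    then show ?thesis using B by blast
  next
    case False
    then obtain g0 where g0: "g0 \<in> W" "g0 i \<noteq> 0" by auto
    have "g \<in> cseq.span (insert g0 B)" if "g \<in> W" for g
    proof -
      let ?c = "g i / g0 i"
      have "g - (\<lambda>n. ?c * g0 n) \<in> W"
        by (intro cseq.subspace_diff cseq.subspace_scale that g0 insert.prems)
      moreover have "(g - (\<lambda>n. ?c * g0 n)) i = 0" using g0 by simp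
      ultimately have "g - (\<lambda>n. ?c * g0 n) \<in> ?W'" by blast
      then have "g - (\<lambda>n. ?c * g0 n) \<in> cseq.span B" using B by blast
      then show ?thesis unfolding cseq.span_insert by blast
    qed
    then show ?thesis using B g0 by (intro exI[of _ "insert g0 B"]) auto
  qed
qed

section \<open>The difference expression of H - z and its lift to \<open>ell2\<close>\<close>

definition jac :: "(int \<Rightarrow> real) \<Rightarrow> complex \<Rightarrow> (int \<Rightarrow> complex) \<Rightarrow> int \<Rightarrow> complex" where
  "jac V z u = (\<lambda>n. u (n + 1) + u (n - 1) + (of_real (V n) - z) * u n)"

lemma schrodinger_minus_eq_jac: "schrodinger V u - (\<lambda>n. z * u n) = jac V z u"
  by (simp add: schrodinger_def jac_def fun_eq_iff algebra_simps)

lemma jac_add: "jac V z (u + v) = jac V z u + jac V z v"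
  and jac_diff: "jac V z (u - v) = jac V z u - jac V z v"
  and jac_scale: "jac V z (\<lambda>n. c * u n) = (\<lambda>n. c * jac V z u n)"
  and jac_zero: "jac V z 0 = 0"
  by (auto simp: jac_def fun_eq_iff algebra_simps)

lemma jac_bounded:
  assumes "u \<in> l2" "\<And>n. \<bar>V n\<bar> \<le> K"
  shows "jac V z u \<in> l2" "l2_norm (jac V z u) \<le> (2 + K + cmod z) * l2_norm u"
proof -
  have K: "0 \<le> K" using assms(2)[of 0] by simp
  have le: "cmod (jac V z u n) \<le> 1 * cmod (u (n + 1)) + 1 * cmod (u (n + (-1))) + (K + cmod z) * cmod (u n) + 0 * cmod (u n)" for n
  proof -
    have "cmod (of_real (V n) - z) \<le> K + cmod z"
      using norm_triangle_ineq4[of "of_real (V n)" z] assms(2)[of n] by simp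
    then have "cmod ((of_real (V n) - z) * u n) \<le> (K + cmod z) * cmod (u n)"
      by (simp add: norm_mult mult_right_mono)
    then show ?thesis
      unfolding jac_def using norm_triangle_ineq[of "u (n + 1) + u (n - 1)" "(of_real (V n) - z) * u n"]
        norm_triangle_ineq[of "u (n + 1)" "u (n - 1)"] by simp
  qed
  have shift: "l2_norm (\<lambda>n. u (n + 1)) = l2_norm u" "l2_norm (\<lambda>n. u (n + (-1))) = l2_norm u"
    by (rule l2_norm_shift)+
  have nn: "0 \<le> (1::real)" "0 \<le> K + cmod z" "0 \<le> (0::real)" using K by auto
  note * = l2_dominated[OF l2_shift[OF assms(1), of 1] l2_shift[OF assms(1), of "-1"] assms(1) assms(1) nn(1) nn(1) nn(2) nn(3) le]
  show "jac V z u \<in> l2" by (rule *(1))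
  show "l2_norm (jac V z u) \<le> (2 + K + cmod z) * l2_norm u"
    using *(2) unfolding shift by (simp only: distrib_right)
qed

definition vanishing :: "int set \<Rightarrow> ell2 set" where
  "vanishing I = {u. \<forall>i\<in>I. Rep_ell2 u i = 0}"

lemma bounded_linear_Rep_ell2: "bounded_linear (\<lambda>u. Rep_ell2 u n)"
  by (rule bounded_linear_intro[of _ 1]) (auto simp: Rep_ell2_simps cmod_Rep_ell2_le scaleR_conv_of_real)

lemma closed_vanishing: "closed (vanishing I)"
proof -
  have "vanishing I = (\<Inter>i\<in>I. {u. Rep_ell2 u i = 0})" by (auto simp: vanishing_def)
  moreover have "closed {u. Rep_ell2 u i = 0}" for i
    by (intro closed_Collect_eq continuous_on_const linear_continuous_on bounded_linear_Rep_ell2)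
  ultimately show ?thesis by auto
qed

lemma subspace_vanishing: "subspace (vanishing I)"
  by (auto simp: subspace_def vanishing_def Rep_ell2_simps)

definition ell2_single :: "int \<Rightarrow> complex \<Rightarrow> ell2" where
  "ell2_single i c = Abs_ell2 (\<lambda>n. if n = i then c else 0)"

lemma Rep_ell2_single: "Rep_ell2 (ell2_single i c) = (\<lambda>n. if n = i then c else 0)"
  unfolding ell2_single_def by (rule Abs_ell2_inverse, rule finite_support_l2) auto

lemma subspace_plus_line:
  assumes "subspace Y"
  shows "subspace {y + t *\<^sub>R b | y t. y \<in> Y}"
proof -
  have "subspace {y + x | y x. y \<in> Y \<and> x \<in> span {b}}"
    by (rule subspace_sums[OF assms subspace_span])
  moreover have "{y + x | y x. y \<in> Y \<and> x \<in> span {b}} = {y + t *\<^sub>R b | y t. y \<in> Y}"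
    by (auto simp: span_singleton)
  ultimately show ?thesis by simp
qed

text \<open>Releasing one coordinate adds two real lines to the image, spanned by the images of the
  site vectors with values 1 and i, and \<open>closed_plus_line\<close> applies to each.\<close>

lemma closed_range_of_vanishing:
  assumes T: "linear (T :: ell2 \<Rightarrow> ell2)" and "finite I" "closed (T ` vanishing I)"
  shows "closed (range T)"
  using assms(2,3)
proof (induction I)
  case empty
  then show ?case by (simp add: vanishing_def)
next
  case (insert i I)
  let ?Y = "T ` vanishing (insert i I)"
  let ?Y1 = "{y + t *\<^sub>R T (ell2_single i 1) | y t. y \<in> ?Y}"
  let ?Y2 = "{y + t *\<^sub>R T (ell2_single i \<i>) | y t. y \<in> ?Y1}"
  have sub: "subspace ?Y" by (rule linear_subspace_image[OF T subspace_vanishing])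
  have "closed ?Y1" by (rule closed_plus_line[OF insert.prems sub])
  then have "closed ?Y2" by (rule closed_plus_line[OF _ subspace_plus_line[OF sub]])
  moreover have "?Y2 = T ` vanishing I"
  proof (intro equalityI subsetI)
    fix x assume "x \<in> ?Y2"
    then obtain u s t where u: "u \<in> vanishing (insert i I)"
      and x: "x = T u + s *\<^sub>R T (ell2_single i 1) + t *\<^sub>R T (ell2_single i \<i>)" by blast
    have "x = T (u + s *\<^sub>R ell2_single i 1 + t *\<^sub>R ell2_single i \<i>)"
      by (simp add: x linear_add[OF T] linear_scale[OF T])
    moreover have "u + s *\<^sub>R ell2_single i 1 + t *\<^sub>R ell2_single i \<i> \<in> vanishing I"
      using u insert.hyps by (auto simp: vanishing_def Rep_ell2_simps Rep_ell2_single)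
    ultimately show "x \<in> T ` vanishing I" by blast
  next
    fix x assume "x \<in> T ` vanishing I"
    then obtain u where u: "u \<in> vanishing I" "x = T u" by blast
    let ?s = "Re (Rep_ell2 u i)" and ?t = "Im (Rep_ell2 u i)"
    let ?v = "u - ?s *\<^sub>R ell2_single i 1 - ?t *\<^sub>R ell2_single i \<i>"
    have "?v \<in> vanishing (insert i I)"
      using u by (auto simp: vanishing_def Rep_ell2_simps Rep_ell2_single complex_eq_iff)
    moreover have "x = T ?v + ?s *\<^sub>R T (ell2_single i 1) + ?t *\<^sub>R T (ell2_single i \<i>)"
      by (simp add: u linear_diff[OF T] linear_scale[OF T])
    ultimately show "x \<in> ?Y2" by blast
  qed
  ultimately show ?case using insert.IH by simp
qed

text \<open>Carries closedness from the class topology of \<open>ell2\<close> to the metric topology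
  in which \<open>l2_fredholm\<close> is stated.\<close>

lemma closedin_l2_of_closed:
  assumes "closed S"
  shows "closedin l2.mtopology (Rep_ell2 ` S)"
  unfolding l2.metric_closedin_iff_sequentially_closed
proof (intro conjI allI impI)
  show "Rep_ell2 ` S \<subseteq> l2" using Rep_ell2 by auto
  fix \<sigma> l
  assume A: "range \<sigma> \<subseteq> Rep_ell2 ` S \<and> limitin l2.mtopology \<sigma> l sequentially"
  then have l: "l \<in> l2" and lim: "(\<lambda>k. l2_dist (\<sigma> k) l) \<longlonglongrightarrow> 0"
    by (auto simp: l2.limitin_metric_dist_null)
  have "\<forall>k. \<exists>s\<in>S. \<sigma> k = Rep_ell2 s" using A by blast
  then obtain s where s: "\<And>k. s k \<in> S" "\<And>k. \<sigma> k = Rep_ell2 (s k)" by metis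
  have "l2_dist (\<sigma> k) l = dist (s k) (Abs_ell2 l)" for k
    unfolding s(2) l2_dist_def dist_norm norm_ell2_def Rep_minus_ell2 Abs_ell2_inverse[OF l] ..
  with lim have "(\<lambda>k. dist (s k) (Abs_ell2 l)) \<longlonglongrightarrow> 0" by (simp only:)
  then have "s \<longlonglongrightarrow> Abs_ell2 l" by (rule tendsto_dist_iff[THEN iffD2])
  with assms s have "Abs_ell2 l \<in> S" by (auto simp: closed_sequential_limits)
  then show "l \<in> Rep_ell2 ` S" using Abs_ell2_inverse[OF l] by (metis imageI)
qed

definition jacT :: "(int \<Rightarrow> real) \<Rightarrow> complex \<Rightarrow> ell2 \<Rightarrow> ell2" where
  "jacT V z u = Abs_ell2 (jac V z (Rep_ell2 u))"

lemma Rep_jacT: "(\<And>n. \<bar>V n\<bar> \<le> K) \<Longrightarrow> Rep_ell2 (jacT V z u) = jac V z (Rep_ell2 u)"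
  unfolding jacT_def by (intro Abs_ell2_inverse jac_bounded(1) Rep_ell2)

lemma bounded_linear_jacT:
  assumes "\<And>n. \<bar>V n\<bar> \<le> K"
  shows "bounded_linear (jacT V z)"
proof (rule bounded_linear_intro[of _ "2 + K + cmod z"])
  show "jacT V z (u + v) = jacT V z u + jacT V z v" for u v
    by (simp add: Rep_ell2_inject[symmetric] Rep_jacT[OF assms] Rep_ell2_simps jac_add)
  show "jacT V z (r *\<^sub>R u) = r *\<^sub>R jacT V z u" for r u
    by (simp add: Rep_ell2_inject[symmetric] Rep_jacT[OF assms] Rep_ell2_simps jac_scale)
  show "norm (jacT V z u) \<le> norm u * (2 + K + cmod z)" for u
    using jac_bounded(2)[OF Rep_ell2[of u] assms, where z = z] by (simp add: norm_ell2_def Rep_jacT[OF assms] mult.commute)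
qed

text \<open>The formal adjoint of \<open>jac V z\<close> is \<open>jac V (cnj z)\<close>. Testing
  with a vector concentrated at \<open>i\<close> evaluates it at that site, as only the sites i - 1,
  i and i + 1 contribute.\<close>

lemma inner_jacT_single:
  assumes "\<And>n. \<bar>V n\<bar> \<le> K"
  shows "g \<bullet> jacT V z (ell2_single i c) = jac V (cnj z) (Rep_ell2 g) i \<bullet> c"
proof -
  have "g \<bullet> jacT V z (ell2_single i c) = (\<Sum>\<^sub>\<infinity>m. Rep_ell2 g m \<bullet> jac V z (Rep_ell2 (ell2_single i c)) m)"
    by (simp add: inner_ell2_def Rep_jacT[OF assms])
  also have "\<dots> = (\<Sum>m\<in>{i - 1, i, i + 1}. Rep_ell2 g m \<bullet> jac V z (Rep_ell2 (ell2_single i c)) m)"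
    by (subst infsum_cong_neutral[where T = "{i - 1, i, i + 1}"]) (auto simp: jac_def Rep_ell2_single)
  also have "\<dots> = jac V (cnj z) (Rep_ell2 g) i \<bullet> c"
    by (simp add: jac_def Rep_ell2_single inner_complex_def algebra_simps)
  finally show ?thesis .
qed

text \<open>The three-term recurrence carries two adjacent zeros outwards. It is available from |n|
  = N + 1 on, so the zeros at N and N + 1, and their mirror images, start it.\<close>

lemma jac_eq_0_outside_imp_0:
  assumes "\<And>n. \<bar>n\<bar> > N \<Longrightarrow> jac V z g n = 0" "\<And>n. \<bar>n\<bar> \<le> N + 1 \<Longrightarrow> g n = 0" "0 \<le> N"
  shows "g = 0"
proof -
  have up: "g (N + int k) = 0 \<and> g (N + int k + 1) = 0" for k
  proof (induction k)
    case (Suc k)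
    from assms(1)[of "N + int k + 1"] \<open>0 \<le> N\<close> Suc show ?case by (simp add: jac_def add_ac)
  qed (use assms in auto)
  have down: "g (- N - int k) = 0 \<and> g (- N - int k - 1) = 0" for k
  proof (induction k)
    case (Suc k)
    from assms(1)[of "- N - int k - 1"] \<open>0 \<le> N\<close> Suc show ?case by (simp add: jac_def algebra_simps)
  qed (use assms in auto)
  have "g n = 0" for n
    using up[of "nat (n - N)"] down[of "nat (- N - n)"] assms(2)[of n] by (cases "n > N"; cases "n < - N") auto
  then show ?thesis by (simp add: fun_eq_iff)
qed

text \<open>The bound makes the image of \<open>vanishing ?I\<close> closed, and finitely many
  released coordinates keep it so. A vector orthogonal to that image solves the adjoint equation off
  the window, hence is determined by finitely many coordinates.\<close>

lemma fredholm_of_lower_bound: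
  assumes K: "\<And>n. \<bar>V n\<bar> \<le> K" and "c > 0" and "N \<ge> 0"
    and lower: "\<And>u. u \<in> l2 \<Longrightarrow> (\<And>n. \<bar>n\<bar> \<le> N \<Longrightarrow> u n = 0) \<Longrightarrow> c * l2_norm u \<le> l2_norm (jac V z u)"
  shows "l2_fredholm (\<lambda>u. schrodinger V u - (\<lambda>n. z * u n))"
  unfolding l2_fredholm_def schrodinger_minus_eq_jac
proof (intro conjI)
  let ?I = "{-N..N}" and ?I' = "{-N-1..N+1}"
  let ?T = "jacT V z"
  \<comment> \<open>With z' = z this space contains the kernel, with z' = \<open>cnj z\<close> the
    orthogonal complement of the image. The window \<open>?I'\<close> exceeds \<open>?I\<close> by
    one site on each side to hold the two adjacent zeros that start the recurrence.\<close>
  have determined: "\<exists>B. finite B \<and> B \<subseteq> {u \<in> l2. \<forall>n. \<bar>n\<bar> > N \<longrightarrow> jac V z' u n = 0}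
      \<and> {u \<in> l2. \<forall>n. \<bar>n\<bar> > N \<longrightarrow> jac V z' u n = 0} \<subseteq> cseq.span B" for z'
  proof (rule finite_basis_of_determining_coordinates[of ?I'])
    show "cseq.subspace {u \<in> l2. \<forall>n. \<bar>n\<bar> > N \<longrightarrow> jac V z' u n = 0}"
      using subspace_l2 unfolding cseq.subspace_def by (auto simp: jac_add jac_scale jac_zero)
    show "g = 0" if "g \<in> {u \<in> l2. \<forall>n. \<bar>n\<bar> > N \<longrightarrow> jac V z' u n = 0}" "\<forall>i\<in>?I'. g i = 0" for g
      using that \<open>0 \<le> N\<close> by (intro jac_eq_0_outside_imp_0[of N V z']) (auto simp: abs_le_iff)
  qed auto
  from determined[of z] show "\<exists>B. finite B \<and> {u \<in> l2. jac V z u = 0} \<subseteq> cseq.span B"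
    by (force simp: fun_eq_iff)
  have bl: "bounded_linear ?T" by (rule bounded_linear_jacT[OF K])
  then have lin: "linear ?T" by (simp add: bounded_linear.linear)
  have "\<forall>u\<in>vanishing ?I. c * norm u \<le> norm (?T u)"
  proof
    fix u assume "u \<in> vanishing ?I"
    then have "Rep_ell2 u n = 0" if "\<bar>n\<bar> \<le> N" for n
      using that by (auto simp: vanishing_def abs_le_iff)
    from lower[OF Rep_ell2 this] show "c * norm u \<le> norm (?T u)"
      by (simp add: norm_ell2_def Rep_jacT[OF K])
  qed
  then have clT: "closed (?T ` vanishing ?I)"
    using complete_isometric_image[OF \<open>c > 0\<close> subspace_vanishing bl]
    by (simp add: complete_eq_closed closed_vanishing)
  then have "closed (range ?T)" by (rule closed_range_of_vanishing[OF lin, rotated]) auto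
  moreover have "Rep_ell2 ` range ?T = jac V z ` l2"
    by (force simp: Rep_jacT[OF K] image_image intro: Rep_ell2 elim: Rep_ell2_cases)
  ultimately show "closedin l2.mtopology (jac V z ` l2)" using closedin_l2_of_closed by metis
  from determined[of "cnj z"] obtain B where B: "finite B" "B \<subseteq> l2"
    "{u \<in> l2. \<forall>n. \<bar>n\<bar> > N \<longrightarrow> jac V (cnj z) u n = 0} \<subseteq> cseq.span B" by blast
  have "\<exists>u\<in>l2. f - jac V z u \<in> cseq.span B" if "f \<in> l2" for f
  proof -
    \<comment> \<open>Projecting onto the image of \<open>vanishing ?I\<close> suffices: it is
      closed, and it contains the images of all site vectors outside the window, against which the
      error \<open>?g\<close> is tested.\<close>
    obtain y where y: "y \<in> ?T ` vanishing ?I" "\<And>v. v \<in> ?T ` vanishing ?I \<Longrightarrow> (Abs_ell2 f - y) \<bullet> v = 0"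
      using orthogonal_projection_exists[OF clT linear_subspace_image[OF lin subspace_vanishing]] by metis
    then obtain u where u: "y = ?T u" by blast
    let ?g = "Abs_ell2 f - y"
    have "jac V (cnj z) (Rep_ell2 ?g) i = 0" if "\<bar>i\<bar> > N" for i
    proof -
      have "ell2_single i c \<in> vanishing ?I" for c using that by (auto simp: vanishing_def Rep_ell2_single)
      then have "jac V (cnj z) (Rep_ell2 ?g) i \<bullet> c = 0" for c
        using y(2) inner_jacT_single[where V = V and g = ?g and z = z and i = i and c = c, OF K] by auto
      then show ?thesis using inner_eq_zero_iff by blast
    qed
    then have "Rep_ell2 ?g \<in> cseq.span B" using B(3) Rep_ell2 by blast
    moreover have "Rep_ell2 ?g = f - jac V z (Rep_ell2 u)"
      by (simp add: Rep_ell2_simps u Rep_jacT[OF K] Abs_ell2_inverse[OF \<open>f \<in> l2\<close>])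
    ultimately show ?thesis using Rep_ell2 by metis
  qed
  with B show "\<exists>B. finite B \<and> B \<subseteq> l2 \<and> (\<forall>f\<in>l2. \<exists>u\<in>l2. f - jac V z u \<in> cseq.span B)" by blast
qed

subsection \<open>Quasimodes at infinity\<close>

lemma exists_annihilating_pair:
  fixes p q :: complex
  shows "\<exists>a b. (a \<noteq> 0 \<or> b \<noteq> 0) \<and> a * p + b * q = 0"
proof (cases "p = 0")
  case True
  then show ?thesis by (intro exI[of _ 1] exI[of _ 0]) simp
next
  case False
  then show ?thesis by (intro exI[of _ q] exI[of _ "- p"]) simp
qed

text \<open>The solutions of \<open>jac V z v = 0\<close> form a space of dimension two, so a fortiori four of them are
  linearly dependent; four is what two applications of elimination in pairs need.\<close>

lemma jac_solutions_dependent: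
  assumes "\<And>i. i < 4 \<Longrightarrow> jac V z (v i) = 0"
  obtains d :: "nat \<Rightarrow> complex" and i where "i < 4" "d i \<noteq> 0" "\<And>n. (\<Sum>i<4. d i * v i n) = 0"
proof -
  \<comment> \<open>Each pair is combined to vanish at 0, the two results to vanish at 1; the
    equation at 0 then yields the zero at -1.\<close>
  obtain a b where ab: "a \<noteq> 0 \<or> b \<noteq> 0" "a * v 0 0 + b * v 1 0 = 0"
    using exists_annihilating_pair by metis
  obtain c e where ce: "c \<noteq> 0 \<or> e \<noteq> 0" "c * v 2 0 + e * v 3 0 = 0"
    using exists_annihilating_pair by metis
  obtain f g where fg: "f \<noteq> 0 \<or> g \<noteq> 0" "f * (a * v 0 1 + b * v 1 1) + g * (c * v 2 1 + e * v 3 1) = 0"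
    using exists_annihilating_pair by metis
  define d where "d = (\<lambda>i::nat. if i = 0 then f * a else if i = 1 then f * b else if i = 2 then g * c else g * e)"
  have sum4: "(\<Sum>i<4. h i) = h 0 + h 1 + h 2 + h 3" for h :: "nat \<Rightarrow> complex"
    by (simp add: eval_nat_numeral)
  define y where "y = (\<lambda>n. \<Sum>i<4. d i * v i n)"
  have y: "y n = f * (a * v 0 n + b * v 1 n) + g * (c * v 2 n + e * v 3 n)" for n
    unfolding y_def sum4 by (simp add: d_def algebra_simps)
  have y0: "y 0 = 0" "y 1 = 0" using ab ce fg by (simp_all add: y)
  have "jac V z y n = (\<Sum>i<4. d i * jac V z (v i) n)" for n
    unfolding y_def jac_def by (simp add: sum.distrib sum_subtractf sum_distrib_left algebra_simps)
  then have jy: "jac V z y n = 0" for n using assms by (simp add: sum4)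
  have "y (- 1) = 0" using jy[of 0] y0 by (simp add: jac_def)
  have "y = 0"
  proof (rule jac_eq_0_outside_imp_0[of 0])
    fix n :: int assume "\<bar>n\<bar> \<le> 0 + 1"
    then have "n = -1 \<or> n = 0 \<or> n = 1" by auto
    then show "y n = 0" using y0 \<open>y (- 1) = 0\<close> by auto
  qed (use jy in auto)
  then have "(\<Sum>i<4. d i * v i n) = 0" for n by (simp add: y_def fun_eq_iff)
  moreover have "d 0 \<noteq> 0 \<or> d 1 \<noteq> 0 \<or> d 2 \<noteq> 0 \<or> d 3 \<noteq> 0"
    using ab(1) ce(1) fg(1) by (simp add: d_def) blast
  moreover have "(0::nat) < 4" "(1::nat) < 4" "(2::nat) < 4" "(3::nat) < 4" by auto
  ultimately show ?thesis using that by blast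
qed

lemma limitin_l2_of_tendsto:
  assumes "X \<longlonglongrightarrow> x"
  shows "limitin l2.mtopology (\<lambda>k. Rep_ell2 (X k)) (Rep_ell2 x) sequentially"
proof -
  have "(\<lambda>k. dist (X k) x) \<longlonglongrightarrow> 0" using assms by (rule tendsto_dist_iff[THEN iffD1])
  then have "(\<lambda>k. l2_dist (Rep_ell2 (X k)) (Rep_ell2 x)) \<longlonglongrightarrow> 0"
    unfolding dist_norm norm_ell2_def Rep_minus_ell2 l2_dist_def .
  then show ?thesis unfolding l2.limitin_metric_dist_null using Rep_ell2 by auto
qed

text \<open>By dependent choice each new radius exceeds the previous support, so the supports are
  disjoint. The bound of \<open>N k\<close> from below by k makes the family locally finite, and the
  geometric bound makes the images summable.\<close>

lemma orthonormal_quasimodes: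
  assumes quasi: "\<And>\<epsilon> N. \<epsilon> > 0 \<Longrightarrow> \<exists>\<phi>. finite {n. \<phi> n \<noteq> 0} \<and> (\<forall>n. \<bar>n\<bar> \<le> N \<longrightarrow> \<phi> n = 0)
      \<and> l2_norm \<phi> > 0 \<and> l2_norm (jac V z \<phi>) \<le> \<epsilon> * l2_norm \<phi>"
  obtains N :: "nat \<Rightarrow> int" and \<phi> where "\<And>k. int k \<le> N k" "\<And>k. N k \<le> N (Suc k)"
    "\<And>k. finite {n. \<phi> k n \<noteq> 0}" "\<And>k n. \<bar>n\<bar> \<le> N k \<Longrightarrow> \<phi> k n = 0" "\<And>k n. \<bar>n\<bar> > N (Suc k) \<Longrightarrow> \<phi> k n = 0"
    "\<And>k. l2_norm (\<phi> k) = 1" "\<And>k. l2_norm (jac V z (\<phi> k)) \<le> (1 / 2) ^ k"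
proof -
  define P where "P = (\<lambda>k (N, \<phi>). int k \<le> N \<and> finite {n. \<phi> n \<noteq> 0} \<and> (\<forall>n. \<bar>n\<bar> \<le> N \<longrightarrow> \<phi> n = 0)
      \<and> l2_norm \<phi> = 1 \<and> l2_norm (jac V z \<phi>) \<le> (1 / 2) ^ k)"
  define Q where "Q = (\<lambda>(k::nat) (N::int, \<phi> :: int \<Rightarrow> complex) (N'::int, \<phi>' :: int \<Rightarrow> complex).
      N \<le> N' \<and> (\<forall>n. \<bar>n\<bar> > N' \<longrightarrow> \<phi> n = 0))"
  have ex: "\<exists>\<phi>. P k (N, \<phi>)" if "int k \<le> N" for k N
  proof -
    from quasi[of "(1/2)^k" N] obtain \<phi> where \<phi>: "finite {n. \<phi> n \<noteq> 0}" "\<forall>n. \<bar>n\<bar> \<le> N \<longrightarrow> \<phi> n = 0"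
      "l2_norm \<phi> > 0" "l2_norm (jac V z \<phi>) \<le> (1/2)^k * l2_norm \<phi>" by auto
    let ?c = "complex_of_real (1 / l2_norm \<phi>)"
    have scale: "l2_norm (\<lambda>n. ?c * u n) = l2_norm u / l2_norm \<phi>" for u
      unfolding l2_norm_scale using \<phi>(3) by (simp add: norm_divide)
    have "l2_norm (\<lambda>n. ?c * \<phi> n) = 1" "l2_norm (jac V z (\<lambda>n. ?c * \<phi> n)) \<le> (1/2)^k"
      unfolding jac_scale scale using \<phi> by (simp_all add: pos_divide_le_eq)
    moreover have "finite {n. ?c * \<phi> n \<noteq> 0}" by (rule finite_subset[OF _ \<phi>(1)]) auto
    ultimately have "P k (N, \<lambda>n. ?c * \<phi> n)"
      unfolding P_def using that \<phi>(2) by simp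
    then show ?thesis by blast
  qed
  have "\<exists>f. \<forall>k. P k (f k) \<and> Q k (f k) (f (Suc k))"
  proof (rule dependent_nat_choice)
    show "\<exists>x. P 0 x" using ex[of 0 0] by auto
  next
    fix x k assume "P k x"
    obtain N \<phi> where x: "x = (N, \<phi>)" by (cases x)
    from \<open>P k x\<close> have "finite {n. \<phi> n \<noteq> 0}" by (simp add: x P_def)
    then have "finite (abs ` {n. \<phi> n \<noteq> 0})" by simp
    then have "\<exists>M. \<forall>m\<in>abs ` {n. \<phi> n \<noteq> 0}. m \<le> M" by (metis bdd_above_finite bdd_above.unfold)
    then obtain M where M: "\<phi> n \<noteq> 0 \<Longrightarrow> \<bar>n\<bar> \<le> M" for n by auto
    let ?N = "max (max N M) (int (Suc k))"
    from ex[of "Suc k" ?N] obtain \<phi>' where "P (Suc k) (?N, \<phi>')" by auto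
    moreover have "Q k x (?N, \<phi>')" using M by (force simp: x Q_def)
    ultimately show "\<exists>y. P (Suc k) y \<and> Q k x y" by blast
  qed
  then obtain f where f: "\<And>k. P k (f k)" "\<And>k. Q k (f k) (f (Suc k))" by blast
  show ?thesis
  proof (rule that[of "\<lambda>k. fst (f k)" "\<lambda>k. snd (f k)"])
    fix k
    show "int k \<le> fst (f k)" "finite {n. snd (f k) n \<noteq> 0}" "l2_norm (snd (f k)) = 1"
      "l2_norm (jac V z (snd (f k))) \<le> (1 / 2) ^ k"
      using f(1)[of k] by (auto simp: P_def case_prod_beta)
    show "fst (f k) \<le> fst (f (Suc k))" using f(2)[of k] by (auto simp: Q_def case_prod_beta)
    show "snd (f k) n = 0" if "\<bar>n\<bar> \<le> fst (f k)" for n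
      using f(1)[of k] that by (auto simp: P_def case_prod_beta)
    show "snd (f k) n = 0" if "\<bar>n\<bar> > fst (f (Suc k))" for n
      using f(2)[of k] that by (auto simp: Q_def case_prod_beta)
  qed
qed

lemma not_fredholm_of_quasimodes:
  assumes K: "\<And>n. \<bar>V n\<bar> \<le> K"
    and quasi: "\<And>\<epsilon> N. \<epsilon> > 0 \<Longrightarrow> \<exists>\<phi>. finite {n. \<phi> n \<noteq> 0} \<and> (\<forall>n. \<bar>n\<bar> \<le> N \<longrightarrow> \<phi> n = 0)
      \<and> l2_norm \<phi> > 0 \<and> l2_norm (jac V z \<phi>) \<le> \<epsilon> * l2_norm \<phi>"
  shows "\<not> l2_fredholm (\<lambda>u. schrodinger V u - (\<lambda>n. z * u n))"
proof
  assume "l2_fredholm (\<lambda>u. schrodinger V u - (\<lambda>n. z * u n))"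
  then have closed_range: "closedin l2.mtopology (jac V z ` l2)"
    unfolding l2_fredholm_def schrodinger_minus_eq_jac by blast
  obtain N :: "nat \<Rightarrow> int" and \<phi> where N: "\<And>k. int k \<le> N k" "\<And>k. N k \<le> N (Suc k)"
    and \<phi>: "\<And>k. finite {n. \<phi> k n \<noteq> 0}" "\<And>k n. \<bar>n\<bar> \<le> N k \<Longrightarrow> \<phi> k n = 0" "\<And>k n. \<bar>n\<bar> > N (Suc k) \<Longrightarrow> \<phi> k n = 0"
      "\<And>k. l2_norm (\<phi> k) = 1" "\<And>k. l2_norm (jac V z (\<phi> k)) \<le> (1 / 2) ^ k"
    using orthonormal_quasimodes[OF quasi] by metis
  have Nmono: "N j \<le> N k" if "j \<le> k" for j k
    using N(2) that by (rule lift_Suc_mono_le)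
  have \<phi>l2: "\<phi> k \<in> l2" for k by (rule finite_support_l2[OF \<phi>(1)])
  have \<phi>0: "\<phi> k n = 0" if "nat \<bar>n\<bar> \<le> k" for k n
    using \<phi>(2)[of n k] N(1)[of k] that by linarith
  \<comment> \<open>The formal sum of the \<open>c k * \<phi> k\<close>: as \<open>\<phi> k\<close>
    vanishes for |n| <= k, the finite sum loses no term. If \<open>c\<close> does not tend to 0, the
    result is not in \<open>l2\<close>.\<close>
  define \<xi> where "\<xi> = (\<lambda>(c :: nat \<Rightarrow> real) n. \<Sum>k\<le>nat \<bar>n\<bar>. complex_of_real (c k) * \<phi> k n)"
  let ?T = "jacT V z"
  have lin: "linear ?T" using bounded_linear_jacT[OF K] by (simp add: bounded_linear.linear)
  \<comment> \<open>The images of the partial sums converge absolutely, and closedness of the range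
    provides a preimage \<open>u\<close> of the limit. Comparing single sites shows that
    \<open>u - \<xi> c\<close> is a formal solution.\<close>
  have formal: "\<exists>u\<in>l2. jac V z (u - \<xi> c) = 0" if c: "\<And>k. \<bar>c k\<bar> \<le> 1" for c
  proof -
    define F where "F = (\<lambda>k. Abs_ell2 (\<phi> k))"
    have RepF: "Rep_ell2 (F k) = \<phi> k" for k by (simp add: F_def Abs_ell2_inverse[OF \<phi>l2])
    define S where "S = (\<lambda>m. \<Sum>k<m. c k *\<^sub>R F k)"
    have RepS: "Rep_ell2 (S m) n = \<xi> c n" if "nat \<bar>n\<bar> < m" for m n
    proof -
      have "Rep_ell2 (S m) n = (\<Sum>k<m. complex_of_real (c k) * \<phi> k n)"
        unfolding S_def using linear_sum[OF bounded_linear.linear[OF bounded_linear_Rep_ell2[of n]], of "\<lambda>k. c k *\<^sub>R F k" "{..<m}"]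
        by (simp add: Rep_ell2_simps RepF)
      also have "\<dots> = \<xi> c n" unfolding \<xi>_def
        by (rule sum.mono_neutral_right) (use that \<phi>0 in auto)
      finally show ?thesis .
    qed
    have TS: "?T (S m) = (\<Sum>k<m. c k *\<^sub>R ?T (F k))" for m
      unfolding S_def by (simp add: linear_sum[OF lin] linear_scale[OF lin])
    have "norm (c k *\<^sub>R ?T (F k)) \<le> (1/2)^k" for k
    proof -
      have "norm (?T (F k)) \<le> (1/2)^k" using \<phi>(5)[of k] by (simp add: norm_ell2_def Rep_jacT[OF K] RepF)
      then show ?thesis using mult_mono[OF c[of k], of "norm (?T (F k))" "(1/2)^k"] by simp
    qed
    then have "summable (\<lambda>k. norm (c k *\<^sub>R ?T (F k)))"
      by (intro summable_comparison_test'[OF summable_geometric[of "1/2 :: real"]]) auto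
    then have "summable (\<lambda>k. c k *\<^sub>R ?T (F k))" by (rule summable_norm_cancel)
    then have lim: "(\<lambda>m. ?T (S m)) \<longlonglongrightarrow> (\<Sum>k. c k *\<^sub>R ?T (F k))" (is "_ \<longlonglongrightarrow> ?y")
      unfolding TS by (rule summable_LIMSEQ)
    have "range (\<lambda>m. Rep_ell2 (?T (S m))) \<subseteq> jac V z ` l2"
      by (auto simp: Rep_jacT[OF K] intro: Rep_ell2)
    then have "Rep_ell2 ?y \<in> jac V z ` l2"
      using closed_range limitin_l2_of_tendsto[OF lim]
      unfolding l2.metric_closedin_iff_sequentially_closed by blast
    then obtain u where u: "u \<in> l2" "Rep_ell2 ?y = jac V z u" by blast
    have "jac V z u n = jac V z (\<xi> c) n" for n
    proof (rule LIMSEQ_unique)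
      show "(\<lambda>m. Rep_ell2 (?T (S m)) n) \<longlonglongrightarrow> jac V z u n"
        unfolding u(2)[symmetric] by (rule bounded_linear.tendsto[OF bounded_linear_Rep_ell2 lim])
      have "\<forall>\<^sub>F m in sequentially. Rep_ell2 (?T (S m)) n = jac V z (\<xi> c) n"
        using eventually_gt_at_top[of "nat \<bar>n\<bar> + 1"]
        by eventually_elim (simp add: Rep_jacT[OF K] jac_def RepS)
      then show "(\<lambda>m. Rep_ell2 (?T (S m)) n) \<longlonglongrightarrow> jac V z (\<xi> c) n" by (rule tendsto_eventually)
    qed
    then have "jac V z (u - \<xi> c) = 0" unfolding jac_diff by (simp add: fun_eq_iff)
    with u show ?thesis by blast
  qed
  \<comment> \<open>One sum per residue class mod 4, to match the four solutions of
    \<open>jac_solutions_dependent\<close>. The classes use different \<open>\<phi> k\<close>, so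
    their linear combination cannot cancel.\<close>
  define c where "c = (\<lambda>i k::nat. if k mod 4 = i then 1 else 0 :: real)"
  have "\<forall>i. \<exists>u\<in>l2. jac V z (u - \<xi> (c i)) = 0" by (intro allI formal) (simp add: c_def)
  then obtain u where u: "\<And>i. u i \<in> l2" "\<And>i. jac V z (u i - \<xi> (c i)) = 0" by metis
  obtain d :: "nat \<Rightarrow> complex" and i where d: "i < 4" "d i \<noteq> 0" "\<And>n. (\<Sum>i<4. d i * (u i - \<xi> (c i)) n) = 0"
    using jac_solutions_dependent[of V z "\<lambda>i. u i - \<xi> (c i)"] u(2) by metis
  define U where "U = (\<Sum>i<4. (\<lambda>n. d i * u i n))"
  have Ul2: "U \<in> l2" unfolding U_def by (intro cseq.subspace_sum[OF subspace_l2] l2_scale u)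
  have Ueq: "U n = (\<Sum>k\<le>nat \<bar>n\<bar>. d (k mod 4) * \<phi> k n)" for n
  proof -
    have sum_apply: "(\<Sum>i<m. f i) n = (\<Sum>i<m. f i n)" for f :: "nat \<Rightarrow> int \<Rightarrow> complex" and m :: nat
      by (induction m) auto
    have "U n = (\<Sum>i<4. d i * u i n)" unfolding U_def by (rule sum_apply)
    also have "\<dots> = (\<Sum>i<4. d i * \<xi> (c i) n)"
      using d(3)[of n] by (simp add: right_diff_distrib sum_subtractf)
    also have "\<dots> = (\<Sum>k\<le>nat \<bar>n\<bar>. \<Sum>i<4. d i * (complex_of_real (c i k) * \<phi> k n))"
      unfolding \<xi>_def sum_distrib_left by (rule sum.swap)
    also have "\<dots> = (\<Sum>k\<le>nat \<bar>n\<bar>. d (k mod 4) * \<phi> k n)"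
    proof (rule sum.cong[OF refl])
      fix k
      have "(\<Sum>i<4. d i * (complex_of_real (c i k) * \<phi> k n)) = (\<Sum>i<4. if i = k mod 4 then d i * \<phi> k n else 0)"
        by (rule sum.cong) (auto simp: c_def)
      then show "(\<Sum>i<4. d i * (complex_of_real (c i k) * \<phi> k n)) = d (k mod 4) * \<phi> k n"
        by (simp add: sum.delta)
    qed
    finally show ?thesis .
  qed
  have Usupp: "U n = d (k mod 4) * \<phi> k n" if n: "N k < \<bar>n\<bar>" "\<bar>n\<bar> \<le> N (Suc k)" for k n
  proof -
    have "\<phi> j n = 0" if "j \<noteq> k" for j
    proof (cases "j < k")
      case True
      then have "N (Suc j) \<le> N k" by (intro Nmono) auto
      then show ?thesis using n by (intro \<phi>(3)) auto
    next
      case False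
      then have "N (Suc k) \<le> N j" using that by (intro Nmono) auto
      then show ?thesis using n by (intro \<phi>(2)) auto
    qed
    then have "U n = (\<Sum>j\<le>nat \<bar>n\<bar>. if j = k then d (k mod 4) * \<phi> k n else 0)"
      unfolding Ueq by (intro sum.cong) auto
    moreover have "k \<le> nat \<bar>n\<bar>" using N(1)[of k] n by linarith
    ultimately show ?thesis by simp
  qed
  let ?A = "\<lambda>k. {n. \<phi> k n \<noteq> 0}"
  have A: "N k < \<bar>n\<bar>" "\<bar>n\<bar> \<le> N (Suc k)" if "n \<in> ?A k" for n k
  proof -
    from that have "\<phi> k n \<noteq> 0" by simp
    then show "N k < \<bar>n\<bar>" "\<bar>n\<bar> \<le> N (Suc k)"
      using \<phi>(2)[of n k] \<phi>(3)[of k n] by (meson not_le)+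
  qed
  have A1: "(\<Sum>n\<in>?A k. (cmod (\<phi> k n))\<^sup>2) = 1" for k
  proof -
    have "(l2_norm (\<phi> k))\<^sup>2 = (\<Sum>\<^sub>\<infinity>n\<in>?A k. (cmod (\<phi> k n))\<^sup>2)"
      unfolding l2_norm_L2[OF \<phi>l2] by (rule infsum_cong_neutral) auto
    then show ?thesis using \<phi>(4)[of k] \<phi>(1)[of k] by (simp add: infsum_finite)
  qed
  \<comment> \<open>Each unit vector with index 4 * j + i contributes the square of
    \<open>cmod (d i)\<close>, so \<open>U\<close> would have infinite norm although it lies in
    \<open>l2\<close>.\<close>
  have "real m * (cmod (d i))\<^sup>2 \<le> (l2_norm U)\<^sup>2" for m
  proof -
    let ?J = "(\<lambda>j. 4 * j + i) ` {..<m}"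
    have disj: "?A j \<inter> ?A k = {}" if "j \<noteq> k" for j k
    proof -
      have False if "n \<in> ?A j" "n \<in> ?A k" "j < k" for n j k
        using A[OF that(1)] A[OF that(2)] Nmono[of "Suc j" k] that(3) by auto
      then show ?thesis using \<open>j \<noteq> k\<close> by (metis (mono_tags, lifting) disjoint_iff linorder_neqE_nat)
    qed
    have "real m * (cmod (d i))\<^sup>2 = (\<Sum>k\<in>?J. (cmod (d i))\<^sup>2)"
      by (subst sum_constant, subst card_image) (auto simp: inj_on_def)
    also have "\<dots> = (\<Sum>k\<in>?J. \<Sum>n\<in>?A k. (cmod (U n))\<^sup>2)"
    proof (rule sum.cong[OF refl])
      fix k assume "k \<in> ?J"
      then have k: "k mod 4 = i" using d(1) by auto
      have "(\<Sum>n\<in>?A k. (cmod (U n))\<^sup>2) = (\<Sum>n\<in>?A k. (cmod (d i))\<^sup>2 * (cmod (\<phi> k n))\<^sup>2)"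
        by (rule sum.cong[OF refl]) (simp add: Usupp[OF A] k norm_mult power_mult_distrib)
      then show "(cmod (d i))\<^sup>2 = (\<Sum>n\<in>?A k. (cmod (U n))\<^sup>2)"
        by (simp add: A1 sum_distrib_left[symmetric])
    qed
    also have "\<dots> = (\<Sum>n\<in>(\<Union>k\<in>?J. ?A k). (cmod (U n))\<^sup>2)"
      by (rule sum.UNION_disjoint[symmetric]) (use \<phi>(1) disj in auto)
    also have "\<dots> \<le> (\<Sum>\<^sub>\<infinity>n. (cmod (U n))\<^sup>2)"
      by (rule finite_sum_le_infsum) (use Ul2 \<phi>(1) in \<open>auto simp: l2_def\<close>)
    finally show ?thesis by (simp add: l2_norm_L2[OF Ul2])
  qed
  moreover obtain m where "(l2_norm U)\<^sup>2 < real m * (cmod (d i))\<^sup>2"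
    using ex_less_of_nat_mult[of "(cmod (d i))\<^sup>2" "(l2_norm U)\<^sup>2"] d(2) by auto
  ultimately show False by (meson not_less)
qed

subsection \<open>Eigenvalues of a single barrier\<close>

text \<open>For a solution of the difference equation the ratios w(n) = u(n) / u(n - 1) satisfy w(n)
  = 1 / (z - a(n) - w(n + 1)). The starting value 0 is a Dirichlet condition behind the k-th
  site.\<close>

primrec cfrac :: "nat \<Rightarrow> real \<Rightarrow> (nat \<Rightarrow> real) \<Rightarrow> real" where
  "cfrac 0 z a = 0"
| "cfrac (Suc k) z a = 1 / (z - a 0 - cfrac k z (\<lambda>i. a (Suc i)))"

definition cfrac_lim :: "real \<Rightarrow> (nat \<Rightarrow> real) \<Rightarrow> real" where
  "cfrac_lim z a = lim (\<lambda>k. cfrac k z a)"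

definition unit_valued :: "('i \<Rightarrow> real) \<Rightarrow> bool" where
  "unit_valued a \<longleftrightarrow> (\<forall>i. 0 \<le> a i \<and> a i \<le> 1)"

lemma unit_valued_comp: "unit_valued a \<Longrightarrow> unit_valued (\<lambda>i. a (f i))"
  by (simp add: unit_valued_def)

text \<open>The interval from 0 to 1 / (z - 2) is invariant: its upper end is at most 1 for z > 3,
  so the denominator is at least z - 1 - 1.\<close>

lemma cfrac_bounds:
  assumes "z > 3" "unit_valued a"
  shows "0 \<le> cfrac k z a \<and> cfrac k z a \<le> 1 / (z - 2)"
  using assms(2)
proof (induction k arbitrary: a)
  case (Suc k)
  have "1 / (z - 2) \<le> 1" using \<open>z > 3\<close> by simp
  moreover have "0 \<le> a 0" "a 0 \<le> 1" using Suc.prems by (auto simp: unit_valued_def)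
  ultimately have "z - 2 \<le> z - a 0 - cfrac k z (\<lambda>i. a (Suc i))"
    using Suc.IH[OF unit_valued_comp[OF Suc.prems, of Suc]] by linarith
  then show ?case using \<open>z > 3\<close> by (auto intro!: divide_left_mono)
qed (use assms in auto)

lemma cfrac_denominator:
  assumes "z > 3" "unit_valued a"
  shows "z - 2 \<le> z - a 0 - cfrac k z (\<lambda>i. a (Suc i))"
proof -
  have "1 / (z - 2) \<le> 1" using \<open>z > 3\<close> by simp
  moreover have "a 0 \<le> 1" using assms by (auto simp: unit_valued_def)
  ultimately show ?thesis
    using cfrac_bounds[OF \<open>z > 3\<close> unit_valued_comp[OF assms(2), of Suc], of k] by linarith
qed

text \<open>The map from w to 1 / (z - a - w) is increasing and 0 is the lower end of the invariant
  interval. Monotonicity yields convergence for every z > 3 without a contraction estimate.\<close>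

lemma cfrac_Suc_mono:
  assumes "z > 3" "unit_valued a"
  shows "cfrac k z a \<le> cfrac (Suc k) z a"
  using assms(2)
proof (induction k arbitrary: a)
  case 0
  then show ?case using cfrac_bounds[OF assms(1) 0, of 1] by simp
next
  case (Suc k)
  have "z - 2 \<le> z - a 0 - cfrac (Suc k) z (\<lambda>i. a (Suc i))"
    by (rule cfrac_denominator[OF assms(1) Suc.prems])
  moreover have "cfrac k z (\<lambda>i. a (Suc i)) \<le> cfrac (Suc k) z (\<lambda>i. a (Suc i))"
    by (rule Suc.IH[OF unit_valued_comp[OF Suc.prems]])
  ultimately have "1 / (z - a 0 - cfrac k z (\<lambda>i. a (Suc i))) \<le> 1 / (z - a 0 - cfrac (Suc k) z (\<lambda>i. a (Suc i)))"
    using assms(1) by (intro divide_left_mono mult_pos_pos) linarith+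
  then show ?case by simp
qed

lemma cfrac_tendsto:
  assumes "z > 3" "unit_valued a"
  shows "(\<lambda>k. cfrac k z a) \<longlonglongrightarrow> cfrac_lim z a"
proof -
  have "incseq (\<lambda>k. cfrac k z a)" by (rule incseq_SucI) (rule cfrac_Suc_mono[OF assms])
  moreover have "bdd_above (range (\<lambda>k. cfrac k z a))"
    using cfrac_bounds[OF assms] by (intro bdd_aboveI[of _ "1 / (z - 2)"]) auto
  ultimately have "convergent (\<lambda>k. cfrac k z a)"
    using LIMSEQ_incseq_SUP by (auto simp: convergent_def)
  then show ?thesis unfolding cfrac_lim_def by (rule convergent_LIMSEQ_iff[THEN iffD1])
qed

lemma cfrac_lim_bounds:
  assumes "z > 3" "unit_valued a"
  shows "0 \<le> cfrac_lim z a" "cfrac_lim z a \<le> 1 / (z - 2)"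
  using LIMSEQ_le_const[OF cfrac_tendsto[OF assms]] LIMSEQ_le_const2[OF cfrac_tendsto[OF assms]]
    cfrac_bounds[OF assms] by blast+

lemma cfrac_lim_denominator:
  assumes "z > 3" "unit_valued a"
  shows "z - 2 \<le> z - a 0 - cfrac_lim z (\<lambda>i. a (Suc i))"
proof -
  have "1 / (z - 2) \<le> 1" using \<open>z > 3\<close> by simp
  moreover have "a 0 \<le> 1" using assms by (auto simp: unit_valued_def)
  ultimately show ?thesis
    using cfrac_lim_bounds(2)[OF \<open>z > 3\<close> unit_valued_comp[OF assms(2), of Suc]] by linarith
qed

lemma cfrac_lim_unfold:
  assumes "z > 3" "unit_valued a"
  shows "cfrac_lim z a = 1 / (z - a 0 - cfrac_lim z (\<lambda>i. a (Suc i)))"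
proof (rule LIMSEQ_unique)
  show "(\<lambda>k. cfrac (Suc k) z a) \<longlonglongrightarrow> cfrac_lim z a"
    using cfrac_tendsto[OF assms] by (rule LIMSEQ_Suc)
  show "(\<lambda>k. cfrac (Suc k) z a) \<longlonglongrightarrow> 1 / (z - a 0 - cfrac_lim z (\<lambda>i. a (Suc i)))"
  proof -
    have "(\<lambda>k. cfrac k z (\<lambda>i. a (Suc i))) \<longlonglongrightarrow> cfrac_lim z (\<lambda>i. a (Suc i))"
      by (rule cfrac_tendsto[OF assms(1) unit_valued_comp[OF assms(2)]])
    moreover have "z - a 0 - cfrac_lim z (\<lambda>i. a (Suc i)) \<noteq> 0"
      using cfrac_lim_denominator[OF assms] \<open>z > 3\<close> by linarith
    ultimately show ?thesis unfolding cfrac.simps by (intro tendsto_intros)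
  qed
qed

text \<open>For z >= 98 all denominators are at least 98 - 2. The constant 1/200 is a generous
  replacement for 1/96^2 that leaves room below 1/100.\<close>

lemma reciprocal_contraction:
  fixes x y :: real
  assumes "x \<ge> 96" "y \<ge> 96"
  shows "\<bar>1 / x - 1 / y\<bar> \<le> \<bar>x - y\<bar> / 200"
proof -
  have "1 / x - 1 / y = (y - x) / (x * y)" using assms by (simp add: field_simps)
  then have "\<bar>1 / x - 1 / y\<bar> = \<bar>x - y\<bar> / (x * y)" using assms by (simp add: abs_mult abs_minus_commute)
  also have "\<dots> \<le> \<bar>x - y\<bar> / 200"
  proof (rule divide_left_mono)
    show "200 \<le> x * y" using mult_mono[of 96 x 96 y] assms by simp
    then show "0 < x * y * 200" by simp
  qed auto
  finally show ?thesis .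
qed

text \<open>Unfolding one common entry contracts the difference of the tails; at the start both
  values lie between 0 and 1.\<close>

lemma cfrac_lim_agree:
  assumes "z \<ge> 98" "unit_valued a" "unit_valued b" "\<And>i. i < k \<Longrightarrow> a i = b i"
  shows "\<bar>cfrac_lim z a - cfrac_lim z b\<bar> \<le> (1 / 100) ^ k"
  using assms(2-)
proof (induction k arbitrary: a b)
  case 0
  have "1 / (z - 2) \<le> 1" using assms(1) by simp
  moreover have "z > 3" using assms(1) by simp
  ultimately show ?case
    unfolding power_0 using cfrac_lim_bounds[OF \<open>z > 3\<close> 0(1)] cfrac_lim_bounds[OF \<open>z > 3\<close> 0(2)] by linarith
next
  case (Suc k)
  let ?a = "\<lambda>i. a (Suc i)" and ?b = "\<lambda>i. b (Suc i)"
  have z: "z > 3" using assms(1) by simp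
  have "\<bar>cfrac_lim z a - cfrac_lim z b\<bar>
      \<le> \<bar>(z - a 0 - cfrac_lim z ?a) - (z - b 0 - cfrac_lim z ?b)\<bar> / 200"
    unfolding cfrac_lim_unfold[OF z Suc.prems(1)] cfrac_lim_unfold[OF z Suc.prems(2)]
    using cfrac_lim_denominator[OF z Suc.prems(1)] cfrac_lim_denominator[OF z Suc.prems(2)] assms(1)
    by (intro reciprocal_contraction) linarith+
  also have "\<dots> = \<bar>cfrac_lim z ?a - cfrac_lim z ?b\<bar> / 200" using Suc.prems(3)[of 0] by simp
  also have "\<dots> \<le> (1 / 100) ^ k / 200"
    using Suc.IH[of ?a ?b] Suc.prems by (simp add: unit_valued_comp divide_right_mono)
  also have "\<dots> \<le> (1 / 100) ^ Suc k" by simp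
  finally show ?case .
qed

text \<open>z enters the denominator directly and through the tail, and (d + d / 100) / 200 <= d /
  100 closes the induction on the truncations.\<close>

lemma cfrac_lim_lipschitz:
  assumes "z \<ge> 98" "z' \<ge> 98" "unit_valued a"
  shows "\<bar>cfrac_lim z a - cfrac_lim z' a\<bar> \<le> \<bar>z - z'\<bar> / 100"
proof -
  have step: "(d + c) / 200 \<le> d / 100" if "c \<le> d / 100" "0 \<le> d" for c d :: real
    using that by simp
  have "\<bar>cfrac k z a - cfrac k z' a\<bar> \<le> \<bar>z - z'\<bar> / 100" for k
    using assms(3)
  proof (induction k arbitrary: a)
    case (Suc k)
    let ?a = "\<lambda>i. a (Suc i)"
    have "\<bar>cfrac (Suc k) z a - cfrac (Suc k) z' a\<bar>
        \<le> \<bar>(z - a 0 - cfrac k z ?a) - (z' - a 0 - cfrac k z' ?a)\<bar> / 200"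
      unfolding cfrac.simps
      using cfrac_denominator[of z a k] cfrac_denominator[of z' a k] assms(1,2) Suc.prems
      by (intro reciprocal_contraction) linarith+
    also have "\<dots> \<le> (\<bar>z - z'\<bar> + \<bar>cfrac k z ?a - cfrac k z' ?a\<bar>) / 200" by simp
    also have "\<dots> \<le> \<bar>z - z'\<bar> / 100" by (rule step[OF Suc.IH[OF unit_valued_comp[OF Suc.prems]] abs_ge_zero])
    finally show ?case .
  qed simp
  moreover have "(\<lambda>k. \<bar>cfrac k z a - cfrac k z' a\<bar>) \<longlonglongrightarrow> \<bar>cfrac_lim z a - cfrac_lim z' a\<bar>"
    using assms by (intro tendsto_intros cfrac_tendsto) auto
  ultimately show ?thesis by (intro LIMSEQ_le_const2) auto
qed

text \<open>Taking reciprocals is injective, so equality descends to the tails until the differing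
  entry is at the head. This strict dependence on distant entries is what makes the eigenvalue set
  perfect.\<close>

lemma cfrac_lim_inj_coordinate:
  assumes "z > 3" "unit_valued a" "unit_valued b" "\<And>i. i \<noteq> j \<Longrightarrow> a i = b i"
    "cfrac_lim z a = cfrac_lim z b"
  shows "a j = b j"
  using assms(2-)
proof (induction j arbitrary: a b)
  case 0
  then have "(\<lambda>i. a (Suc i)) = (\<lambda>i. b (Suc i))" by auto
  with 0 cfrac_lim_unfold[OF assms(1) 0(1)] cfrac_lim_unfold[OF assms(1) 0(2)]
    cfrac_lim_denominator[OF assms(1) 0(1)] cfrac_lim_denominator[OF assms(1) 0(2)] assms(1)
  show ?case by (auto simp: frac_eq_eq)
next
  case (Suc j)
  have "cfrac_lim z (\<lambda>i. a (Suc i)) = cfrac_lim z (\<lambda>i. b (Suc i))"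
    using Suc.prems(3)[of 0] Suc.prems(4) cfrac_lim_unfold[OF assms(1) Suc.prems(1)]
      cfrac_lim_unfold[OF assms(1) Suc.prems(2)]
      cfrac_lim_denominator[OF assms(1) Suc.prems(1)] cfrac_lim_denominator[OF assms(1) Suc.prems(2)] assms(1)
    by (auto simp: frac_eq_eq)
  then show ?case using Suc.IH[of "\<lambda>i. a (Suc i)" "\<lambda>i. b (Suc i)"] Suc.prems by (auto simp: unit_valued_comp)
qed

text \<open>For \<open>x\<close> with values in \<open>{0,1}\<close> off the site \<open>0\<close>, where the potential is \<open>100\<close>, the zeros of \<open>gap z x\<close> in
  \<open>z > 3\<close> are the eigenvalues: the two continued fractions are the ratios \<open>u(\<plusminus>1)/u(0)\<close> of the
  solution decaying on the respective side. The value \<open>x 0\<close> plays no role.\<close>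

definition gap :: "real \<Rightarrow> (int \<Rightarrow> real) \<Rightarrow> real" where
  "gap z x = z - 100 - cfrac_lim z (\<lambda>i. x (1 + int i)) - cfrac_lim z (\<lambda>i. x (- 1 - int i))"

definition eigval :: "(int \<Rightarrow> real) \<Rightarrow> real" where
  "eigval x = (SOME e. e \<in> {98..102} \<and> gap e x = 0)"

text \<open>The term z dominates the two fractions, whose Lipschitz constants are 1/100 each. Thus
  zeros are unique, and distance from the zero bounds \<open>gap\<close> from below.\<close>

lemma gap_expanding:
  assumes "z \<ge> 98" "z' \<ge> 98" "unit_valued x"
  shows "\<bar>z - z'\<bar> / 2 \<le> \<bar>gap z x - gap z' x\<bar>"
proof -
  let ?A = "\<lambda>z. cfrac_lim z (\<lambda>i. x (1 + int i))" and ?B = "\<lambda>z. cfrac_lim z (\<lambda>i. x (- 1 - int i))"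
  have "\<bar>z - z'\<bar> - \<bar>?A z - ?A z'\<bar> - \<bar>?B z - ?B z'\<bar> \<le> \<bar>gap z x - gap z' x\<bar>"
    unfolding gap_def by linarith
  moreover have "\<bar>?A z - ?A z'\<bar> \<le> \<bar>z - z'\<bar> / 100" "\<bar>?B z - ?B z'\<bar> \<le> \<bar>z - z'\<bar> / 100"
    by (rule cfrac_lim_lipschitz[OF assms(1,2) unit_valued_comp[OF assms(3)]])+
  moreover have "d / 2 \<le> g" if "d - a - b \<le> g" "a \<le> d / 100" "b \<le> d / 100" "0 \<le> d" for a b d g :: real
    using that by linarith
  ultimately show ?thesis using abs_ge_zero by blast
qed

text \<open>A zero of \<open>gap\<close> is a fixed point of e = 100 + w + w' with w and w' between
  0 and 1, a contraction of [98,102] into itself.\<close>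

lemma eigval:
  assumes "unit_valued x"
  shows "eigval x \<in> {98..102}" "gap (eigval x) x = 0"
proof -
  note ur = unit_valued_comp[OF assms, of "\<lambda>i. 1 + int i"] and ul = unit_valued_comp[OF assms, of "\<lambda>i. - 1 - int i"]
  let ?f = "\<lambda>e. 100 + cfrac_lim e (\<lambda>i. x (1 + int i)) + cfrac_lim e (\<lambda>i. x (- 1 - int i))"
  have "\<exists>!e. e \<in> {98..102} \<and> ?f e = e"
  proof (rule Banach_fix[of _ "1/2"])
    show "?f ` {98..102} \<subseteq> {98..102}"
    proof clarify
      fix e :: real assume e: "e \<in> {98..102}"
      then have "1 / (e - 2) \<le> 1" "e > 3" by simp_all
      then show "?f e \<in> {98..102}"
        using cfrac_lim_bounds[OF \<open>e > 3\<close> ur] cfrac_lim_bounds[OF \<open>e > 3\<close> ul]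
        unfolding atLeastAtMost_iff by (intro conjI; linarith)
    qed
    show "dist (?f e) (?f e') \<le> 1 / 2 * dist e e'" if "e \<in> {98..102}" "e' \<in> {98..102}" for e e'
    proof -
      let ?A = "\<lambda>z. cfrac_lim z (\<lambda>i. x (1 + int i))" and ?B = "\<lambda>z. cfrac_lim z (\<lambda>i. x (- 1 - int i))"
      have "dist (?f e) (?f e') \<le> \<bar>?A e - ?A e'\<bar> + \<bar>?B e - ?B e'\<bar>"
        unfolding dist_real_def by linarith
      also have "\<dots> \<le> \<bar>e - e'\<bar> / 100 + \<bar>e - e'\<bar> / 100"
        using that ur ul by (intro add_mono cfrac_lim_lipschitz) auto
      also have "\<dots> \<le> 1 / 2 * dist e e'" by (simp add: dist_real_def)
      finally show ?thesis .
    qed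
  qed (auto simp: complete_eq_closed)
  then obtain e where "e \<in> {98..102}" "?f e = e" by blast
  moreover from this(2) have "gap e x = 0" unfolding gap_def by linarith
  ultimately have "\<exists>e. e \<in> {98..102} \<and> gap e x = 0" by blast
  from someI_ex[OF this] show "eigval x \<in> {98..102}" "gap (eigval x) x = 0"
    unfolding eigval_def by blast+
qed

text \<open>At \<open>eigval y\<close> the gap of \<open>y\<close> vanishes and that of
  \<open>x\<close> is the error of the two fractions. The factor 4 is one 2 for the two fractions
  and one from \<open>gap_expanding\<close>.\<close>

lemma eigval_agree:
  assumes "unit_valued x" "unit_valued y" "\<And>i. \<bar>i\<bar> \<le> int k \<Longrightarrow> x i = y i"
  shows "\<bar>eigval x - eigval y\<bar> \<le> 4 * (1 / 100) ^ k"
proof -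
  let ?e = "eigval y"
  have e: "?e \<ge> 98" using eigval(1)[OF assms(2)] by simp
  have "\<bar>eigval x - ?e\<bar> / 2 \<le> \<bar>gap (eigval x) x - gap ?e x\<bar>"
    using eigval(1)[OF assms(1)] e assms(1) by (intro gap_expanding) auto
  also have "\<dots> = \<bar>gap ?e y - gap ?e x\<bar>" by (simp add: eigval assms)
  also have "\<dots> \<le> \<bar>cfrac_lim ?e (\<lambda>i. x (1 + int i)) - cfrac_lim ?e (\<lambda>i. y (1 + int i))\<bar>
      + \<bar>cfrac_lim ?e (\<lambda>i. x (- 1 - int i)) - cfrac_lim ?e (\<lambda>i. y (- 1 - int i))\<bar>"
    unfolding gap_def by linarith
  also have "\<dots> \<le> (1 / 100) ^ k + (1 / 100) ^ k"
    by (rule add_mono; rule cfrac_lim_agree[OF e unit_valued_comp[OF assms(1)] unit_valued_comp[OF assms(2)]])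
      (use assms(3) in auto)
  finally show ?thesis by simp
qed

section \<open>The eigenvalues of all binary patterns form a Cantor set\<close>

definition binary :: "(int \<Rightarrow> real) set" where
  "binary = (UNIV \<rightarrow>\<^sub>E {0, 1})"

lemma binary_iff: "x \<in> binary \<longleftrightarrow> (\<forall>i. x i = 0 \<or> x i = 1)"
  by (auto simp: binary_def)

lemma binary_unit_valued: "x \<in> binary \<Longrightarrow> unit_valued x"
  unfolding binary_iff unit_valued_def by (metis order_refl zero_le_one)

lemma compact_binary: "compact binary"
proof -
  have "compactin (product_topology (\<lambda>_::int. euclidean) UNIV) (UNIV \<rightarrow>\<^sub>E {0, 1::real})"
    unfolding compactin_PiE by (simp add: finite_imp_compact)
  then show ?thesis by (simp add: binary_def euclidean_product_topology)
qed

lemma continuous_on_eigval: "continuous_on binary eigval"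
  unfolding continuous_on_def
proof (intro ballI tendstoI)
  fix x and e :: real assume x: "x \<in> binary" and "e > 0"
  then obtain k where k: "(1 / 100 :: real) ^ k < e / 4" using real_arch_pow_inv[of "e/4" "1/100"] by auto
  \<comment> \<open>A neighbourhood in the product topology: closeness below 1 at a site forces
    equality of values in {0,1}.\<close>
  let ?S = "\<Inter>i\<in>{- int k..int k}. {y. \<bar>y i - x i\<bar> < 1}"
  have "open {y::int \<Rightarrow> real. \<bar>y i - x i\<bar> < 1}" for i
    by (intro open_Collect_less continuous_intros continuous_on_product_coordinates)
  then have "open ?S" by (intro open_INT) auto
  moreover have "x \<in> ?S" by simp
  moreover have "dist (eigval y) (eigval x) < e" if y: "y \<in> ?S" "y \<in> binary" for y
  proof -
    have "y i = x i" if "\<bar>i\<bar> \<le> int k" for i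
    proof -
      have "\<bar>y i - x i\<bar> < 1" using y(1) that by (auto simp: abs_le_iff)
      moreover have "y i = 0 \<or> y i = 1" "x i = 0 \<or> x i = 1" using x y(2) by (auto simp: binary_iff)
      ultimately show ?thesis by auto
    qed
    then show ?thesis using eigval_agree[of y x k] k x y(2) by (simp add: binary_unit_valued dist_real_def)
  qed
  ultimately show "\<forall>\<^sub>F y in at x within binary. dist (eigval y) (eigval x) < e"
    unfolding eventually_at_topological by blast
qed

text \<open>For j > 0 only the right-hand fraction sees the change, so equal eigenvalues would make
  the two right-hand fractions equal at the same energy.\<close>

lemma eigval_flip_neq:
  assumes "x \<in> binary" "j > 0"
  shows "eigval (x(j := 1 - x j)) \<noteq> eigval x"
proof
  let ?y = "x(j := 1 - x j)" and ?e = "eigval x"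
  assume eq: "eigval ?y = ?e"
  have y: "?y \<in> binary" using assms by (auto simp: binary_iff)
  note u = binary_unit_valued[OF assms(1)] binary_unit_valued[OF y]
  have e: "?e > 3" using eigval(1)[OF u(1)] by simp
  have "(\<lambda>i. ?y (- 1 - int i)) = (\<lambda>i. x (- 1 - int i))" using assms(2) by auto
  then have "cfrac_lim ?e (\<lambda>i. ?y (1 + int i)) = cfrac_lim ?e (\<lambda>i. x (1 + int i))"
    using eigval(2)[OF u(1)] eigval(2)[OF u(2)] eq unfolding gap_def by simp
  moreover have "?y (1 + int i) = x (1 + int i)" if "i \<noteq> nat (j - 1)" for i
    using that assms(2) by auto
  ultimately have "?y (1 + int (nat (j - 1))) = x (1 + int (nat (j - 1)))"
    using cfrac_lim_inj_coordinate[OF e unit_valued_comp[OF u(2), of "\<lambda>i. 1 + int i"]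
      unit_valued_comp[OF u(1), of "\<lambda>i. 1 + int i"], of "nat (j - 1)"] by blast
  moreover have "x j = 0 \<or> x j = 1" using assms(1) by (auto simp: binary_iff)
  ultimately show False using assms(2) by auto
qed

text \<open>Place \<open>?M\<close> + 1 equidistant points in the interval, one more than there are
  patterns on the window of radius k. Two of them share a pattern, so their spacing is at most 4 /
  100^k, whence b - a <= 8 / 25^k.\<close>

lemma no_interval_in_eigval_image:
  assumes "a < b" "{a..b} \<subseteq> eigval ` binary"
  shows False
proof -
  obtain k where k: "(1 / 25 :: real) ^ k < (b - a) / 8"
    using real_arch_pow_inv[of "(b - a) / 8" "1/25"] assms(1) by auto
  let ?I = "{- int k..int k}"
  let ?M = "2 ^ (2 * k + 1) :: nat"
  define p where "p = (\<lambda>j::nat. a + real j * ((b - a) / real ?M))"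
  have "p j \<in> {a..b}" if "j \<le> ?M" for j
  proof -
    have "real j * ((b - a) / real ?M) \<le> real ?M * ((b - a) / real ?M)"
      using that assms(1) by (intro mult_right_mono) (auto simp flip: of_nat_power)
    then show ?thesis using assms(1) by (simp add: p_def)
  qed
  then have "\<forall>j\<in>{..?M}. \<exists>x\<in>binary. eigval x = p j" using assms(2) by (metis atMost_iff imageE subsetD)
  then obtain X where X: "\<And>j. j \<le> ?M \<Longrightarrow> X j \<in> binary \<and> eigval (X j) = p j" by (metis atMost_iff)
  let ?r = "\<lambda>j. restrict (X j) ?I"
  have "?r ` {..?M} \<subseteq> ?I \<rightarrow>\<^sub>E {0, 1}" using X by (force simp: binary_iff)
  moreover have fin: "finite (?I \<rightarrow>\<^sub>E {0, 1::real})" by (intro finite_PiE) auto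
  moreover have "card (?I \<rightarrow>\<^sub>E {0, 1::real}) = ?M"
  proof -
    have "card ?I = 2 * k + 1" "card {0, 1 :: real} = 2" by auto
    then show ?thesis by (simp only: card_PiE[OF finite_atLeastAtMost_int] prod_constant)
  qed
  ultimately have "card (?r ` {..?M}) \<le> ?M" by (metis card_mono)
  then have "\<not> inj_on ?r {..?M}" by (intro pigeonhole) simp
  then obtain i j where ij: "i \<le> ?M" "j \<le> ?M" "i \<noteq> j" "?r i = ?r j" by (auto simp: inj_on_def)
  have "X i l = X j l" if "\<bar>l\<bar> \<le> int k" for l
    using fun_cong[OF ij(4), of l] that by (auto simp: abs_le_iff)
  then have "\<bar>p i - p j\<bar> \<le> 4 * (1 / 100) ^ k"
    using eigval_agree[of "X i" "X j" k] X[OF ij(1)] X[OF ij(2)] binary_unit_valued by metis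
  moreover have "\<bar>p i - p j\<bar> = \<bar>real i - real j\<bar> * ((b - a) / real ?M)"
  proof -
    have "p i - p j = (real i - real j) * ((b - a) / real ?M)"
      unfolding p_def left_diff_distrib by linarith
    moreover have "0 \<le> (b - a) / real ?M" using assms(1) by simp
    ultimately show ?thesis by (simp only: abs_mult abs_of_nonneg)
  qed
  moreover have "1 * ((b - a) / real ?M) \<le> \<bar>real i - real j\<bar> * ((b - a) / real ?M)"
    using ij(3) assms(1) by (intro mult_right_mono) auto
  ultimately have "(b - a) / real ?M \<le> 4 * (1 / 100) ^ k" by linarith
  then have "b - a \<le> 4 * (1 / 100) ^ k * real ?M" by (simp add: pos_divide_le_eq)
  also have "\<dots> = 8 * (1 / 25) ^ k"
  proof -
    have "(1 / 100 :: real) ^ k * 4 ^ k = (1 / 25) ^ k" by (simp flip: power_mult_distrib)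
    moreover have "real ?M = 2 * 4 ^ k" by (simp add: power_mult)
    ultimately show ?thesis by simp
  qed
  finally show False using k by simp
qed

text \<open>Between 98 and 102 uniformity in \<open>x\<close> comes from compactness of the
  eigenvalue set. Below 98 the nonnegative fractions only push \<open>gap\<close> further from 0;
  above 102 they add up to at most 1.\<close>

lemma gap_bounded_below:
  assumes "z > 3" "z \<notin> eigval ` binary"
  obtains \<delta> where "\<delta> > 0" "\<And>x. x \<in> binary \<Longrightarrow> \<delta> \<le> \<bar>gap z x\<bar>"
proof -
  have b: "0 \<le> cfrac_lim z (\<lambda>i. x (f i))" "cfrac_lim z (\<lambda>i. x (f i)) \<le> 1 / (z - 2)" if "x \<in> binary"
    for x :: "int \<Rightarrow> real" and f :: "nat \<Rightarrow> int"
    using cfrac_lim_bounds[OF \<open>z > 3\<close> unit_valued_comp[OF binary_unit_valued[OF that], of f]] by auto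
  consider "z < 98" | "z > 102" | "z \<in> {98..102}" by fastforce
  then show ?thesis
  proof cases
    case 1
    have "1 \<le> \<bar>gap z x\<bar>" if "x \<in> binary" for x
      unfolding gap_def using b(1)[OF that, of "\<lambda>i. 1 + int i"] b(1)[OF that, of "\<lambda>i. - 1 - int i"] 1 by linarith
    then show ?thesis using that[of 1] by auto
  next
    case 2
    then have "1 / (z - 2) \<le> 1 / 2" by simp
    then have "1 \<le> \<bar>gap z x\<bar>" if "x \<in> binary" for x
      unfolding gap_def using b(2)[OF that, of "\<lambda>i. 1 + int i"] b(2)[OF that, of "\<lambda>i. - 1 - int i"] 2 by linarith
    then show ?thesis using that[of 1] by auto
  next
    case 3
    have "closed (eigval ` binary)"
      by (intro compact_imp_closed compact_continuous_image continuous_on_eigval compact_binary)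
    with assms(2) obtain d where d: "d > 0" "\<And>y. y \<in> eigval ` binary \<Longrightarrow> d \<le> dist z y"
      using separate_point_closed by metis
    have "d / 2 \<le> \<bar>gap z x\<bar>" if "x \<in> binary" for x
    proof -
      have u: "unit_valued x" by (rule binary_unit_valued[OF that])
      have "d / 2 \<le> \<bar>z - eigval x\<bar> / 2" using d(2)[of "eigval x"] that by (simp add: dist_real_def)
      also have "\<dots> \<le> \<bar>gap z x - gap (eigval x) x\<bar>"
        using 3 eigval(1)[OF u] u by (intro gap_expanding) auto
      finally show ?thesis by (simp add: eigval(2)[OF u])
    qed
    then show ?thesis using that[of "d / 2"] d(1) by auto
  qed
qed

lemma cantor_set_eigval_image: "cantor_set (eigval ` binary)"
  unfolding cantor_set_def
proof (intro conjI ballI)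
  let ?C = "eigval ` binary"
  have "(\<lambda>_. 0) \<in> binary" by (simp add: binary_iff)
  then show "?C \<noteq> {}" by blast
  show "compact ?C" by (intro compact_continuous_image continuous_on_eigval compact_binary)
  fix e assume "e \<in> ?C"
  then obtain x where x: "x \<in> binary" "e = eigval x" by blast
  show "e islimpt ?C"
    unfolding islimpt_approachable
  proof (intro allI impI)
    fix r :: real assume "r > 0"
    then obtain k where k: "(1 / 100 :: real) ^ k < r / 4" using real_arch_pow_inv[of "r/4" "1/100"] by auto
    \<comment> \<open>The first site to the right of the window of radius k: flipping it moves the
      eigenvalue by less than r, but does move it.\<close>
    let ?j = "int k + 1"
    let ?y = "x(?j := 1 - x ?j)"
    have y: "?y \<in> binary" using x by (auto simp: binary_iff)
    have "\<bar>eigval ?y - eigval x\<bar> \<le> 4 * (1 / 100) ^ k"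
      using x y by (intro eigval_agree binary_unit_valued) auto
    then have "dist (eigval ?y) e < r" using k x by (simp add: dist_real_def)
    moreover have "eigval ?y \<noteq> e" using eigval_flip_neq[of x ?j] x by simp
    ultimately show "\<exists>x'\<in>?C. x' \<noteq> e \<and> dist x' e < r" using y by blast
  qed
  have conn: "connected (connected_component_set ?C e)" by (rule connected_connected_component)
  have "y = e" if "y \<in> connected_component_set ?C e" for y
  proof (rule ccontr)
    assume "y \<noteq> e"
    have "e \<in> connected_component_set ?C e" using \<open>e \<in> ?C\<close> by (simp add: connected_component_refl_eq)
    then have "{min y e..max y e} \<subseteq> connected_component_set ?C e"
      using connected_contains_Icc[OF conn] that by (cases "y \<le> e") (auto simp: min_def max_def)
    also have "\<dots> \<subseteq> ?C" by (rule connected_component_subset)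
    finally show False using no_interval_in_eigval_image[of "min y e" "max y e"] \<open>y \<noteq> e\<close> by linarith
  qed
  then show "connected_component_set ?C e = {e}" using \<open>e \<in> ?C\<close> by (auto simp: connected_component_refl_eq)
qed

subsection \<open>Lower bounds\<close>

lemma infsum_diff_real:
  fixes f g :: "'i \<Rightarrow> real"
  assumes "f summable_on A" "g summable_on A"
  shows "(\<lambda>i. f i - g i) summable_on A" "(\<Sum>\<^sub>\<infinity>i\<in>A. f i - g i) = infsum f A - infsum g A"
proof -
  have g: "(\<lambda>i. - g i) summable_on A"
    using summable_on_cmult_right[OF assms(2), of "- 1"] by simp
  show "(\<lambda>i. f i - g i) summable_on A" using summable_on_add[OF assms(1) g] by simp
  show "(\<Sum>\<^sub>\<infinity>i\<in>A. f i - g i) = infsum f A - infsum g A"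
    using infsum_add[OF assms(1) g] by (simp add: infsum_uminus)
qed

text \<open>The real inner product with i * u isolates an imaginary part: the hopping terms
  telescope, the real potential drops out, and - Im z times the squared norm remains.\<close>

lemma lower_bound_nonreal:
  assumes K: "\<And>n. \<bar>V n\<bar> \<le> K" and u: "u \<in> l2"
  shows "\<bar>Im z\<bar> * l2_norm u \<le> l2_norm (jac V z u)"
proof -
  have iu: "(\<lambda>n. \<i> * u n) \<in> l2" by (rule l2_scale[OF u])
  have ju: "jac V z u \<in> l2" by (rule jac_bounded(1)[OF u K])
  let ?s = "\<lambda>n. u (n + 1) \<bullet> (\<i> * u n)"
  have s: "?s summable_on UNIV" by (rule l2_inner_summable[OF l2_shift[OF u] iu])
  have bij: "bij_betw (\<lambda>n::int. n - 1) UNIV UNIV"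
    by (rule bij_betwI[where g = "\<lambda>n. n + 1"]) auto
  have s': "(\<lambda>n. ?s (n - 1)) summable_on UNIV"
    using summable_on_reindex_bij_betw[OF bij, of ?s] s by blast
  have u2: "(\<lambda>n. Im z * (cmod (u n))\<^sup>2) summable_on UNIV"
    using u unfolding l2_def by (auto intro: summable_on_cmult_right)
  have "jac V z u n \<bullet> (\<i> * u n) = ?s n - ?s (n - 1) - Im z * (cmod (u n))\<^sup>2" for n
    unfolding jac_def inner_complex_def cmod_power2 by (simp add: algebra_simps power2_eq_square)
  then have "Abs_ell2 (jac V z u) \<bullet> Abs_ell2 (\<lambda>n. \<i> * u n) = (\<Sum>\<^sub>\<infinity>n. ?s n - ?s (n - 1) - Im z * (cmod (u n))\<^sup>2)"
    by (simp add: inner_ell2_def Abs_ell2_inverse[OF iu] Abs_ell2_inverse[OF ju])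
  also have "\<dots> = (\<Sum>\<^sub>\<infinity>n. ?s n - ?s (n - 1)) - (\<Sum>\<^sub>\<infinity>n. Im z * (cmod (u n))\<^sup>2)"
    by (intro infsum_diff_real s s' u2)
  also have "(\<Sum>\<^sub>\<infinity>n. ?s n - ?s (n - 1)) = 0"
  proof -
    have "(\<Sum>\<^sub>\<infinity>n. ?s n - ?s (n - 1)) = infsum ?s UNIV - (\<Sum>\<^sub>\<infinity>n. ?s (n - 1))"
      by (intro infsum_diff_real s s')
    then show ?thesis using infsum_reindex_bij_betw[OF bij, of ?s] by simp
  qed
  also have "(\<Sum>\<^sub>\<infinity>n. Im z * (cmod (u n))\<^sup>2) = Im z * (l2_norm u)\<^sup>2"
    by (simp add: l2_norm_L2[OF u] infsum_cmult_right')
  finally have "\<bar>Im z\<bar> * (l2_norm u)\<^sup>2 = \<bar>Abs_ell2 (jac V z u) \<bullet> Abs_ell2 (\<lambda>n. \<i> * u n)\<bar>"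
    by (simp add: abs_mult)
  also have "\<dots> \<le> norm (Abs_ell2 (jac V z u)) * norm (Abs_ell2 (\<lambda>n. \<i> * u n))"
    by (rule Cauchy_Schwarz_ineq2)
  also have "\<dots> = l2_norm (jac V z u) * l2_norm u"
    by (simp add: norm_ell2_def Abs_ell2_inverse[OF iu] Abs_ell2_inverse[OF ju] l2_norm_scale)
  finally show ?thesis
    using l2_norm_nonneg[of u] l2_norm_nonneg[of "jac V z u"]
    by (cases "l2_norm u = 0") (auto simp: power2_eq_square)
qed

text \<open>Since V >= 0, the diagonal part is at least - x, while the two shifts have norm at most
  2 together.\<close>

lemma lower_bound_below:
  assumes K: "\<And>n. 0 \<le> V n \<and> V n \<le> K" and u: "u \<in> l2" and "x \<le> - 2"
  shows "(- x - 2) * l2_norm u \<le> l2_norm (jac V (of_real x) u)"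
proof -
  let ?j = "jac V (of_real x) u"
  have ju: "?j \<in> l2" using K by (intro jac_bounded(1)[OF u, of V K]) (auto simp: abs_le_iff intro: order_trans[of _ 0])
  have le: "cmod (of_real (- x) * u n) \<le> 1 * cmod (?j n) + 1 * cmod (u (n + 1)) + 1 * cmod (u (n + (-1))) + 0 * cmod (u n)" for n
  proof -
    have "cmod (of_real (- x) * u n) \<le> cmod (of_real (V n - x) * u n)"
      unfolding norm_mult norm_of_real using K[of n] \<open>x \<le> - 2\<close> by (intro mult_right_mono) auto
    also have "of_real (V n - x) * u n = ?j n - u (n + 1) - u (n - 1)" by (simp add: jac_def)
    also have "cmod \<dots> \<le> cmod (?j n) + cmod (u (n + 1)) + cmod (u (n - 1))"
      using norm_triangle_ineq4[of "?j n - u (n + 1)" "u (n - 1)"] norm_triangle_ineq4[of "?j n" "u (n + 1)"] by linarith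
    finally show ?thesis by simp
  qed
  have "l2_norm (\<lambda>n. of_real (- x) * u n) \<le> 1 * l2_norm ?j + 1 * l2_norm (\<lambda>n. u (n + 1)) + 1 * l2_norm (\<lambda>n. u (n + (-1))) + 0 * l2_norm u"
    by (rule l2_dominated(2)[OF ju l2_shift[OF u] l2_shift[OF u] u _ _ _ _ le]) auto
  then have "\<bar>x\<bar> * l2_norm u \<le> l2_norm ?j + 2 * l2_norm u"
    unfolding l2_norm_shift l2_norm_scale norm_of_real by simp
  moreover have "\<bar>x\<bar> = - x" using \<open>x \<le> - 2\<close> by simp
  ultimately show ?thesis by (simp add: left_diff_distrib)
qed

lemma restrict_l2:
  assumes "u \<in> l2"
  shows "(\<lambda>n. if n \<in> S then u n else 0) \<in> l2"
  by (rule l2_norm_mono(1)[OF assms]) auto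

text \<open>Runs the recursion from distance m + 1 in to distance 1 for all base points at once;
  \<open>R j\<close> collects the values at distance 1 + j. The far end is damped by q^m, the
  sources add up to a geometric series.\<close>

lemma sweep_bound:
  fixes r f :: "int \<Rightarrow> complex" and \<sigma> :: int
  assumes r: "r \<in> l2" and f: "f \<in> l2" and q: "0 \<le> q" "q < 1"
    and step: "\<And>n j. n \<in> S \<Longrightarrow> j < m \<Longrightarrow>
      cmod (r (n + \<sigma> * (1 + int j))) \<le> q * (cmod (r (n + \<sigma> * (2 + int j))) + cmod (f (n + \<sigma> * (1 + int j))))"
  shows "l2_norm (\<lambda>n. if n \<in> S then r (n + \<sigma>) else 0) \<le> q ^ m * l2_norm r + q / (1 - q) * l2_norm f"
proof -
  define R where "R = (\<lambda>j::nat. \<lambda>n. if n \<in> S then r (n + \<sigma> * (1 + int j)) else 0)"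
  have Rl2: "R j \<in> l2" for j unfolding R_def by (rule restrict_l2[OF l2_shift[OF r]])
  have R1: "l2_norm (R j) \<le> q * l2_norm (R (Suc j)) + q * l2_norm f" if "j < m" for j
  proof -
    have "l2_norm (R j) \<le> q * l2_norm (R (Suc j)) + q * l2_norm (\<lambda>n. f (n + \<sigma> * (1 + int j))) + 0 * l2_norm f + 0 * l2_norm f"
    proof (rule l2_dominated(2)[OF Rl2 l2_shift[OF f] f f])
      show "cmod (R j n) \<le> q * cmod (R (Suc j) n) + q * cmod (f (n + \<sigma> * (1 + int j))) + 0 * cmod (f n) + 0 * cmod (f n)" for n
        using step[of n j] that q by (auto simp: R_def algebra_simps)
    qed (use q in auto)
    then show ?thesis by (simp add: l2_norm_shift)
  qed
  have "d \<le> m \<Longrightarrow> l2_norm (R (m - d)) \<le> q ^ d * l2_norm (R m) + q / (1 - q) * l2_norm f" for d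
  proof (induction d)
    case 0
    then show ?case using q l2_norm_nonneg[of f] by simp
  next
    case (Suc d)
    have "m - Suc d < m" "Suc (m - Suc d) = m - d" using Suc.prems by auto
    with R1[of "m - Suc d"] have "l2_norm (R (m - Suc d)) \<le> q * l2_norm (R (m - d)) + q * l2_norm f" by simp
    also have "\<dots> \<le> q * (q ^ d * l2_norm (R m) + q / (1 - q) * l2_norm f) + q * l2_norm f"
      using Suc q by (intro add_right_mono mult_left_mono) auto
    also have "\<dots> = q ^ Suc d * l2_norm (R m) + (q * (q / (1 - q)) + q) * l2_norm f" by (simp add: algebra_simps)
    also have "q * (q / (1 - q)) + q = q / (1 - q)" using q by (simp add: field_simps)
    finally show ?case .
  qed
  from this[of m] have "l2_norm (R 0) \<le> q ^ m * l2_norm (R m) + q / (1 - q) * l2_norm f" by simp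
  also have "l2_norm (R m) \<le> l2_norm (\<lambda>n. r (n + \<sigma> * (1 + int m)))"
    by (rule l2_norm_mono(2)[OF l2_shift[OF r]]) (auto simp: R_def)
  then have "q ^ m * l2_norm (R m) \<le> q ^ m * l2_norm r"
    unfolding l2_norm_shift using q by (intro mult_left_mono) auto
  finally have "l2_norm (R 0) \<le> q ^ m * l2_norm r + q / (1 - q) * l2_norm f" by simp
  moreover have "R 0 = (\<lambda>n. if n \<in> S then r (n + \<sigma>) else 0)" by (auto simp: R_def fun_eq_iff)
  ultimately show ?thesis by simp
qed

text \<open>The factors \<open>wr\<close> and \<open>wl\<close> of the decaying solutions turn the difference equation off the sites with
  \<open>V = 100\<close> into the two first order recursions satisfied by \<open>r\<close> and \<open>s\<close>, which are contracting towards
  such a site. There they leave the scalar equation \<open>gap z _ * u n = f n + r (n + 1) + s (n - 1)\<close>.\<close>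

lemma lower_bound_above:
  fixes V :: "int \<Rightarrow> real" and z :: real
  assumes z: "z > 3" "z \<notin> eigval ` binary"
    and V: "\<And>n. V n = 0 \<or> V n = 1 \<or> V n = 100"
    and sparse: "\<And>L :: nat. \<exists>N\<ge>0. \<forall>i j. V i = 100 \<longrightarrow> V j = 100 \<longrightarrow> \<bar>i\<bar> > N \<longrightarrow> \<bar>j\<bar> > N \<longrightarrow> i \<noteq> j \<longrightarrow> int L \<le> \<bar>i - j\<bar>"
  shows "\<exists>c>0. \<exists>N\<ge>0. \<forall>u\<in>l2. (\<forall>n. \<bar>n\<bar> \<le> N \<longrightarrow> u n = 0) \<longrightarrow> c * l2_norm u \<le> l2_norm (jac V (of_real z) u)"
proof -
  obtain \<delta> where \<delta>: "\<delta> > 0" "\<And>x. x \<in> binary \<Longrightarrow> \<delta> \<le> \<bar>gap z x\<bar>"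
    using gap_bounded_below[OF z] by metis
  define q where "q = 1 / (z - 2)"
  have q: "0 < q" "q < 1" using z(1) by (auto simp: q_def)
  define C where "C = q / (1 - q)"
  have C: "C \<ge> 0" using q by (simp add: C_def)
  \<comment> \<open>In the final estimate the damped far ends cost 100 * 4 * q^m / \<delta> norms of
    \<open>u\<close>; this choice keeps the cost within (z - 3) / 2, half of the surplus.\<close>
  obtain m where m: "q ^ m < (z - 3) * \<delta> / 800"
    using real_arch_pow_inv[of "(z - 3) * \<delta> / 800" q] z(1) \<delta>(1) q by auto
  obtain N where N: "N \<ge> 0" "\<And>i j. V i = 100 \<Longrightarrow> V j = 100 \<Longrightarrow> \<bar>i\<bar> > N \<Longrightarrow> \<bar>j\<bar> > N \<Longrightarrow> i \<noteq> j \<Longrightarrow> int (m + 1) \<le> \<bar>i - j\<bar>"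
    using sparse[of "m + 1"] by metis
  \<comment> \<open>A - 1 is the cost of \<open>100 * X\<close> in norms of \<open>f\<close>; the
    remaining 1 comes from the direct estimate \<open>u_le\<close>.\<close>
  define A where "A = 1 + 100 * (1 + 2 * C) / \<delta>"
  have A: "A > 0" using C \<delta>(1) by (auto simp: A_def intro!: add_pos_nonneg)
  \<comment> \<open>With the barriers erased, the fractions at every site see 0 and 1 only. What was
    erased returns as the source \<open>100 * X\<close>.\<close>
  define W where "W = (\<lambda>n. if V n = 100 then 0 else V n)"
  have W: "(\<lambda>i. W (g i)) \<in> binary" for g using V by (auto simp: W_def binary_iff)
  have Wu: "unit_valued (\<lambda>i::nat. W (g i))" for g
    using V unfolding W_def unit_valued_def by (smt (verit))
  define wr where "wr = (\<lambda>n. cfrac_lim z (\<lambda>i. W (n + int i)))"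
  define wl where "wl = (\<lambda>n. cfrac_lim z (\<lambda>i. W (n - int i)))"
  have wr_b: "0 \<le> wr n" "wr n \<le> q" and wl_b: "0 \<le> wl n" "wl n \<le> q" for n
    unfolding wr_def wl_def q_def by (rule cfrac_lim_bounds[OF z(1) Wu])+
  have wr_eq: "wr n = 1 / (z - W n - wr (n + 1))" and wr_den: "z - W n - wr (n + 1) \<noteq> 0" for n
    using cfrac_lim_unfold[OF z(1) Wu, of "\<lambda>i. n + int i"] cfrac_lim_denominator[OF z(1) Wu, of "\<lambda>i. n + int i"] z(1)
    unfolding wr_def by (auto simp: add_ac)
  have wl_eq: "wl n = 1 / (z - W n - wl (n - 1))" and wl_den: "z - W n - wl (n - 1) \<noteq> 0" for n
    using cfrac_lim_unfold[OF z(1) Wu, of "\<lambda>i. n - int i"] cfrac_lim_denominator[OF z(1) Wu, of "\<lambda>i. n - int i"] z(1)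
    unfolding wl_def by (auto simp: algebra_simps)
  have gap_eq: "gap z (\<lambda>i. W (n + i)) = z - 100 - wr (n + 1) - wl (n - 1)" for n
    unfolding gap_def wr_def wl_def by (simp add: algebra_simps)
  have K: "\<bar>V n\<bar> \<le> 100" for n using V[of n] by auto
  have "(z - 3) / 2 / A * l2_norm u \<le> l2_norm (jac V (of_real z) u)" if u: "u \<in> l2" and u0: "\<And>n. \<bar>n\<bar> \<le> N \<Longrightarrow> u n = 0" for u
  proof -
    define f where "f = (\<lambda>n. - jac V (of_real z) u n)"
    have f_eq: "f n = (of_real z - of_real (V n)) * u n - u (n + 1) - u (n - 1)" for n
      by (simp add: f_def jac_def algebra_simps)
    have ju: "jac V (of_real z) u \<in> l2" by (rule jac_bounded(1)[OF u K])
    have fl2: "f \<in> l2" and f_norm: "l2_norm f = l2_norm (jac V (of_real z) u)"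
      using l2_scale[OF ju, of "-1"] l2_norm_scale[of "-1" "jac V (of_real z) u"] by (simp_all add: f_def)
    define X where "X = (\<lambda>n. if V n = 100 then u n else 0)"
    have Xl2: "X \<in> l2" unfolding X_def by (rule l2_norm_mono(1)[OF u]) auto
    have fX: "f n + 100 * X n = (of_real z - of_real (W n)) * u n - u (n + 1) - u (n - 1)" for n
      by (auto simp: f_eq X_def W_def algebra_simps)
    define r where "r = (\<lambda>n. u n - of_real (wr n) * u (n - 1))"
    define s where "s = (\<lambda>n. u n - of_real (wl n) * u (n + 1))"
    \<comment> \<open>Multiply the equation by \<open>wr n\<close> and use that
      \<open>wr n * (z - W n - wr (n + 1))\<close> is 1.\<close>
    have r_rec: "r n = of_real (wr n) * (r (n + 1) + (f n + 100 * X n))" for n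
    proof -
      have "r (n + 1) + (f n + 100 * X n) = of_real (z - W n - wr (n + 1)) * u n - u (n - 1)"
        unfolding fX by (simp add: r_def algebra_simps)
      moreover have "of_real (wr n) * (of_real (z - W n - wr (n + 1)) :: complex) = 1"
        unfolding of_real_mult[symmetric] using wr_eq[of n] wr_den[of n] by simp
      ultimately show ?thesis by (simp add: r_def right_diff_distrib flip: mult.assoc)
    qed
    have s_rec: "s n = of_real (wl n) * (s (n - 1) + (f n + 100 * X n))" for n
    proof -
      have "s (n - 1) + (f n + 100 * X n) = of_real (z - W n - wl (n - 1)) * u n - u (n + 1)"
        unfolding fX by (simp add: s_def algebra_simps)
      moreover have "of_real (wl n) * (of_real (z - W n - wl (n - 1)) :: complex) = 1"
        unfolding of_real_mult[symmetric] using wl_eq[of n] wl_den[of n] by simp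
      ultimately show ?thesis by (simp add: s_def right_diff_distrib flip: mult.assoc)
    qed
    have small: "cmod (of_real w * y) \<le> cmod y" if "0 \<le> w" "w \<le> q" for w y
      using that q by (simp add: norm_mult mult_left_le_one_le)
    have r_le: "cmod (r n) \<le> 1 * cmod (u n) + 1 * cmod (u (n + (-1))) + 0 * cmod (u n) + 0 * cmod (u n)" for n
      using norm_triangle_ineq4[of "u n" "of_real (wr n) * u (n - 1)"] small[OF wr_b, of n "u (n - 1)"] by (simp add: r_def)
    have s_le: "cmod (s n) \<le> 1 * cmod (u n) + 1 * cmod (u (n + 1)) + 0 * cmod (u n) + 0 * cmod (u n)" for n
      using norm_triangle_ineq4[of "u n" "of_real (wl n) * u (n + 1)"] small[OF wl_b, of n "u (n + 1)"] by (simp add: s_def)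
    have nn: "0 \<le> (1::real)" "0 \<le> (0::real)" by auto
    note rl2 = l2_dominated[OF u l2_shift[OF u] u u nn(1,1,2,2) r_le]
      and sl2 = l2_dominated[OF u l2_shift[OF u] u u nn(1,1,2,2) s_le]
    define S where "S = {n. V n = 100 \<and> \<bar>n\<bar> > N}"
    \<comment> \<open>A source this close would sit on a second barrier; those outside the radius
      \<open>N\<close> are at least m + 1 away, and at those inside it \<open>u\<close>
      vanishes.\<close>
    have X0: "X (n + k) = 0" if "n \<in> S" "k \<noteq> 0" "\<bar>k\<bar> \<le> int m" for n k
    proof (rule ccontr)
      assume "X (n + k) \<noteq> 0"
      then have "V (n + k) = 100" "u (n + k) \<noteq> 0" by (auto simp: X_def split: if_splits)
      moreover from this(2) have "\<bar>n + k\<bar> > N" using u0[of "n + k"] by (meson not_le)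
      ultimately have "V (n + k) = 100" "\<bar>n + k\<bar> > N" by auto
      with N(2)[of "n + k" n] that show False by (auto simp: S_def)
    qed
    have contract: "cmod (of_real w * (a + (b + 100 * x))) \<le> q * (cmod a + cmod b)"
      if "0 \<le> w" "w \<le> q" "x = 0" for w a b x
    proof -
      have "cmod (of_real w * (a + (b + 100 * x))) = w * cmod (a + b)" using that by (simp add: norm_mult)
      also have "\<dots> \<le> q * (cmod a + cmod b)" using that q by (intro mult_mono norm_triangle_ineq) auto
      finally show ?thesis .
    qed
    have Rr: "l2_norm (\<lambda>n. if n \<in> S then r (n + 1) else 0) \<le> q ^ m * l2_norm r + C * l2_norm f"
      unfolding C_def
    proof (rule sweep_bound[OF rl2(1) fl2])
      fix n j assume nj: "n \<in> S" "j < m"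
      have "cmod (r (n + (1 + int j))) \<le> q * (cmod (r (n + (1 + int j) + 1)) + cmod (f (n + (1 + int j))))"
        by (subst r_rec, rule contract[OF wr_b], rule X0[OF nj(1)]) (use nj(2) in auto)
      then show "cmod (r (n + 1 * (1 + int j))) \<le> q * (cmod (r (n + 1 * (2 + int j))) + cmod (f (n + 1 * (1 + int j))))"
        by (simp add: algebra_simps)
    qed (use q in auto)
    have Rs: "l2_norm (\<lambda>n. if n \<in> S then s (n + (-1)) else 0) \<le> q ^ m * l2_norm s + C * l2_norm f"
      unfolding C_def
    proof (rule sweep_bound[OF sl2(1) fl2])
      fix n j assume nj: "n \<in> S" "j < m"
      have "cmod (s (n + (- 1 - int j))) \<le> q * (cmod (s (n + (- 1 - int j) - 1)) + cmod (f (n + (- 1 - int j))))"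
        by (subst s_rec, rule contract[OF wl_b], rule X0[OF nj(1)]) (use nj(2) in auto)
      then show "cmod (s (n + (-1) * (1 + int j))) \<le> q * (cmod (s (n + (-1) * (2 + int j))) + cmod (f (n + (-1) * (1 + int j))))"
        by (simp add: algebra_simps)
    qed (use q in auto)
    have X_le: "cmod (of_real \<delta> * X n) \<le> 1 * cmod (f n) + 1 * cmod (if n \<in> S then r (n + 1) else 0)
        + 1 * cmod (if n \<in> S then s (n + (-1)) else 0) + 0 * cmod (u n)" for n
    proof (cases "n \<in> S")
      case True
      then have V100: "V n = 100" by (simp add: S_def)
      have "of_real (gap z (\<lambda>i. W (n + i))) * u n = f n + r (n + 1) + s (n - 1)"
        unfolding gap_eq f_eq r_def s_def V100 by (simp add: algebra_simps)
      moreover have "cmod (of_real \<delta> * X n) \<le> cmod (of_real (gap z (\<lambda>i. W (n + i))) * u n)"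
        using \<delta>(2)[OF W, of "\<lambda>i. n + i"] \<delta>(1) V100 by (simp add: norm_mult X_def mult_right_mono)
      ultimately show ?thesis
        using True norm_triangle_ineq[of "f n + r (n + 1)" "s (n - 1)"] norm_triangle_ineq[of "f n" "r (n + 1)"] by simp
    next
      case False
      then have "X n = 0" using u0[of n] by (auto simp: S_def X_def)
      then show ?thesis by simp
    qed
    have "l2_norm (\<lambda>n. of_real \<delta> * X n) \<le> 1 * l2_norm f + 1 * l2_norm (\<lambda>n. if n \<in> S then r (n + 1) else 0)
        + 1 * l2_norm (\<lambda>n. if n \<in> S then s (n + (-1)) else 0) + 0 * l2_norm u"
      by (rule l2_dominated(2)[OF fl2 restrict_l2[OF l2_shift[OF rl2(1)]] restrict_l2[OF l2_shift[OF sl2(1)]] u nn(1,1,1,2) X_le])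
    then have "\<delta> * l2_norm X \<le> l2_norm f + (q ^ m * l2_norm r + C * l2_norm f) + (q ^ m * l2_norm s + C * l2_norm f)"
      unfolding l2_norm_scale norm_of_real using Rr Rs \<delta>(1) by simp
    also have "\<dots> \<le> l2_norm f + (q ^ m * (2 * l2_norm u) + C * l2_norm f) + (q ^ m * (2 * l2_norm u) + C * l2_norm f)"
      using rl2(2) sl2(2) q unfolding l2_norm_shift by (intro add_mono mult_left_mono order_refl) auto
    finally have "\<delta> * l2_norm X \<le> (1 + 2 * C) * l2_norm f + 4 * q ^ m * l2_norm u" by (simp add: algebra_simps)
    also have "\<dots> \<le> (1 + 2 * C) * l2_norm f + 4 * ((z - 3) * \<delta> / 800) * l2_norm u"
      by (intro add_left_mono mult_right_mono) (use m l2_norm_nonneg[of u] in linarith)+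
    finally have X1: "\<delta> * l2_norm X \<le> (1 + 2 * C) * l2_norm f + 4 * ((z - 3) * \<delta> / 800) * l2_norm u" .
    have "\<delta> * (A - 1) = 100 * (1 + 2 * C)" using \<delta>(1) by (simp add: A_def)
    then have "\<delta> * ((A - 1) * l2_norm f + (z - 3) / 2 * l2_norm u)
        = 100 * ((1 + 2 * C) * l2_norm f + 4 * ((z - 3) * \<delta> / 800) * l2_norm u)"
      by (simp add: distrib_left flip: mult.assoc)
    moreover have "\<delta> * (100 * l2_norm X) = 100 * (\<delta> * l2_norm X)" by simp
    ultimately have "\<delta> * (100 * l2_norm X) \<le> \<delta> * ((A - 1) * l2_norm f + (z - 3) / 2 * l2_norm u)"
      using mult_left_mono[OF X1, of 100] by simp
    then have X_norm: "100 * l2_norm X \<le> (A - 1) * l2_norm f + (z - 3) / 2 * l2_norm u"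
      using \<delta>(1) by simp
    \<comment> \<open>With the barriers erased, the diagonal is at least z - 1 against shifts of
      total norm 2; the surplus z - 3 controls \<open>u\<close> by \<open>f\<close> and
      \<open>X\<close>.\<close>
    have u_le: "cmod (of_real (z - 1) * u n) \<le> 1 * cmod (f n) + 1 * cmod (u (n + 1)) + 1 * cmod (u (n + (-1))) + 100 * cmod (X n)" for n
    proof -
      have "cmod (of_real (z - 1) * u n) \<le> cmod (of_real (z - W n) * u n)"
        unfolding norm_mult norm_of_real using V[of n] z(1) by (intro mult_right_mono) (auto simp: W_def)
      also have "of_real (z - W n) * u n = (f n + u (n + 1) + u (n - 1)) + 100 * X n"
        using fX[of n] by (simp add: algebra_simps)
      also have "cmod \<dots> \<le> cmod (f n) + cmod (u (n + 1)) + cmod (u (n - 1)) + cmod (100 * X n)"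
        by (intro order_trans[OF norm_triangle_ineq] add_right_mono) simp
      finally show ?thesis by (simp add: norm_mult)
    qed
    have "l2_norm (\<lambda>n. of_real (z - 1) * u n) \<le> 1 * l2_norm f + 1 * l2_norm (\<lambda>n. u (n + 1)) + 1 * l2_norm (\<lambda>n. u (n + (-1))) + 100 * l2_norm X"
      by (rule l2_dominated(2)[OF fl2 l2_shift[OF u] l2_shift[OF u] Xl2 _ _ _ _ u_le]) auto
    then have "(z - 1) * l2_norm u \<le> l2_norm f + 2 * l2_norm u + 100 * l2_norm X"
      unfolding l2_norm_scale l2_norm_shift norm_of_real using z(1) by simp
    then have "(z - 3) * l2_norm u \<le> l2_norm f + 100 * l2_norm X" by (simp add: algebra_simps)
    moreover have "(z - 3) / 2 * l2_norm u = (z - 3) * l2_norm u / 2" "(A - 1) * l2_norm f = A * l2_norm f - l2_norm f"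
      by (simp_all add: left_diff_distrib)
    ultimately have "(z - 3) / 2 * l2_norm u \<le> A * l2_norm f" using X_norm by linarith
    then show ?thesis unfolding f_norm using A by (simp add: field_simps)
  qed
  moreover have "(z - 3) / 2 / A > 0" using A z(1) by simp
  ultimately show ?thesis using N(1) by blast
qed

subsection \<open>The essential spectrum for a fixed potential\<close>

lemma l2_norm_finite_support:
  assumes "finite A" "\<And>n. n \<notin> A \<Longrightarrow> u n = 0"
  shows "l2_norm u = L2_set (\<lambda>n. cmod (u n)) A"
proof -
  have "(\<Sum>\<^sub>\<infinity>n. (cmod (u n))\<^sup>2) = (\<Sum>\<^sub>\<infinity>n\<in>A. (cmod (u n))\<^sup>2)"
    by (rule infsum_cong_neutral) (use assms in auto)
  then show ?thesis using assms by (simp add: l2_norm_def L2_set_def infsum_finite)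
qed

text \<open>Cutting off a solution leaves errors at the two end sites and their outer neighbours.
  These four may coincide for short windows, hence only an upper bound for the cardinality.\<close>

lemma l2_norm_le_of_four_sites:
  assumes "\<And>n. n \<notin> {a, b, c, d} \<Longrightarrow> u n = 0" "\<And>n. cmod (u n) \<le> M" "0 \<le> M"
  shows "l2_norm u \<le> 4 * M"
proof -
  have "l2_norm u = L2_set (\<lambda>n. cmod (u n)) {a, b, c, d}"
    by (rule l2_norm_finite_support) (use assms in auto)
  also have "\<dots> \<le> (\<Sum>n\<in>{a, b, c, d}. cmod (u n))" by (rule L2_set_le_sum) auto
  also have "\<dots> \<le> of_nat (card {a, b, c, d}) * M" by (rule sum_bounded_above) (use assms in auto)
  also have "\<dots> \<le> 4 * M"
  proof -
    have "card {a, b, c, d} \<le> 4" using card_length[of "[a, b, c, d]"] by simp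
    then show ?thesis using assms(3) by (intro mult_right_mono) auto
  qed
  finally show ?thesis .
qed

text \<open>The cut-off error stays below 16 (four sites, each at most 1 + 1 + 2) while the norm of
  the wave grows like the square root of its length.\<close>

lemma plane_wave_quasimode:
  fixes V :: "int \<Rightarrow> real" and z c :: real
  assumes "\<bar>z - c\<bar> \<le> 2" "\<epsilon> > 0"
    and intervals: "\<And>L :: nat. \<exists>p. \<forall>n. p \<le> n \<and> n < p + int L \<longrightarrow> V n = c \<and> \<bar>n\<bar> > N"
  shows "\<exists>\<phi>. finite {n. \<phi> n \<noteq> 0} \<and> (\<forall>n. \<bar>n\<bar> \<le> N \<longrightarrow> \<phi> n = 0)
      \<and> l2_norm \<phi> > 0 \<and> l2_norm (jac V (of_real z) \<phi>) \<le> \<epsilon> * l2_norm \<phi>"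
proof -
  obtain L :: nat where L: "(16 / \<epsilon>)\<^sup>2 < real L" using reals_Archimedean2 by blast
  then have "16 / \<epsilon> < sqrt (real L)" using \<open>\<epsilon> > 0\<close> by (intro real_less_rsqrt) auto
  then have L16: "16 \<le> \<epsilon> * sqrt (real L)" using \<open>\<epsilon> > 0\<close> by (simp add: field_simps)
  obtain p where p: "\<And>n. p \<le> n \<Longrightarrow> n < p + int L \<Longrightarrow> V n = c \<and> \<bar>n\<bar> > N" using intervals[of L] by blast
  \<comment> \<open>The wave number from the dispersion relation z = c + 2 cos \<theta>.\<close>
  define \<theta> where "\<theta> = arccos ((z - c) / 2)"
  have cos: "2 * cos \<theta> = z - c" using assms(1) by (simp add: \<theta>_def abs_le_iff)
  define \<phi> where "\<phi> = (\<lambda>n. if p \<le> n \<and> n < p + int L then cis (\<theta> * of_int n) else 0)"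
  have wave: "cis (\<theta> * of_int (n + 1)) + cis (\<theta> * of_int (n - 1)) = of_real (z - c) * cis (\<theta> * of_int n)" for n
    unfolding cos[symmetric] by (simp add: complex_eq_iff distrib_left right_diff_distrib cos_add cos_diff sin_add sin_diff)
  have supp: "finite {n. \<phi> n \<noteq> 0}" by (rule finite_subset[of _ "{p..<p + int L}"]) (auto simp: \<phi>_def)
  have norm: "l2_norm \<phi> = sqrt (real L)"
    by (subst l2_norm_finite_support[of "{p..<p + int L}"]) (auto simp: \<phi>_def L2_set_def)
  have "l2_norm (jac V (of_real z) \<phi>) \<le> 4 * 4"
  proof (rule l2_norm_le_of_four_sites[of "p - 1" p "p + int L - 1" "p + int L"])
    fix n assume n: "n \<notin> {p - 1, p, p + int L - 1, p + int L}"
    show "jac V (of_real z) \<phi> n = 0"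
    proof (cases "p \<le> n \<and> n < p + int L")
      case True
      then have "\<phi> n = cis (\<theta> * of_int n)" "\<phi> (n + 1) = cis (\<theta> * of_int (n + 1))" "\<phi> (n - 1) = cis (\<theta> * of_int (n - 1))"
        using n by (auto simp: \<phi>_def)
      then show ?thesis unfolding jac_def using wave[of n] p[of n] True by (simp add: algebra_simps)
    next
      case False
      then have "\<phi> n = 0" "\<phi> (n + 1) = 0" "\<phi> (n - 1) = 0" using n by (auto simp: \<phi>_def)
      then show ?thesis by (simp add: jac_def)
    qed
  next
    fix n
    have \<phi>1: "cmod (\<phi> k) \<le> 1" for k by (simp add: \<phi>_def)
    have "cmod ((of_real (V n) - of_real z) * \<phi> n) \<le> 2"
    proof (cases "p \<le> n \<and> n < p + int L")
      case True
      then have "cmod ((of_real (V n) - of_real z) * \<phi> n) = cmod (of_real (c - z))"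
        using p[of n] by (simp add: \<phi>_def norm_mult)
      then show ?thesis using assms(1) by (simp only: norm_of_real abs_minus_commute)
    qed (auto simp: \<phi>_def)
    then show "cmod (jac V (of_real z) \<phi> n) \<le> 4"
      unfolding jac_def using \<phi>1[of "n + 1"] \<phi>1[of "n - 1"] norm_triangle_ineq[of "\<phi> (n + 1)" "\<phi> (n - 1)"]
        norm_triangle_ineq[of "\<phi> (n + 1) + \<phi> (n - 1)" "(of_real (V n) - of_real z) * \<phi> n"] by linarith
  qed auto
  then have "l2_norm (jac V (of_real z) \<phi>) \<le> \<epsilon> * l2_norm \<phi>" using L16 by (simp add: norm)
  moreover have "l2_norm \<phi> > 0" using L16 \<open>\<epsilon> > 0\<close> by (auto simp: norm intro: Nat.gr0I)
  moreover have "\<phi> n = 0" if "\<bar>n\<bar> \<le> N" for n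
  proof (rule ccontr)
    assume "\<phi> n \<noteq> 0"
    then have "\<bar>n\<bar> > N" using p[of n] by (auto simp: \<phi>_def split: if_splits)
    then show False using that by simp
  qed
  ultimately show ?thesis using supp by blast
qed

section \<open>Bound states of a single barrier and their truncations\<close>

primrec decaying :: "real \<Rightarrow> (nat \<Rightarrow> real) \<Rightarrow> nat \<Rightarrow> real" where
  "decaying z a 0 = 1"
| "decaying z a (Suc k) = decaying z a k * cfrac_lim z (\<lambda>i. a (k + i))"

text \<open>\<open>a k\<close> belongs to position \<open>Suc k\<close>, as position 0 is the
  barrier. The recurrence is the unfolded continued fraction times the product accumulated so
  far.\<close>

lemma decaying_recurrence:
  assumes "z > 3" "unit_valued a"
  shows "decaying z a (Suc (Suc k)) + decaying z a k + (a k - z) * decaying z a (Suc k) = 0"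
proof -
  have u: "unit_valued (\<lambda>i. a (k + i))" by (rule unit_valued_comp[OF assms(2)])
  let ?w = "cfrac_lim z (\<lambda>i. a (k + i))" and ?w' = "cfrac_lim z (\<lambda>i. a (Suc k + i))"
  have "?w * (z - a k - ?w') = 1"
    using cfrac_lim_unfold[OF assms(1) u] cfrac_lim_denominator[OF assms(1) u] assms(1) by simp
  then have "decaying z a k * (1 - ?w * (z - a k - ?w')) = 0" by simp
  then show ?thesis by (simp add: algebra_simps)
qed

lemma decaying_bound:
  assumes "z \<ge> 98" "unit_valued a"
  shows "\<bar>decaying z a k\<bar> \<le> (1 / 2) ^ k"
proof (induction k)
  case (Suc k)
  have z: "z > 3" using assms(1) by simp
  have "1 / (z - 2) \<le> 1 / 2" using assms(1) by simp
  then have "\<bar>cfrac_lim z (\<lambda>i. a (k + i))\<bar> \<le> 1 / 2"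
    using cfrac_lim_bounds[OF z unit_valued_comp[OF assms(2), of "\<lambda>i. k + i"]] by linarith
  then have "\<bar>decaying z a (Suc k)\<bar> \<le> (1 / 2) ^ k * (1 / 2)"
    unfolding decaying.simps abs_mult by (intro mult_mono Suc) auto
  then show ?case by simp
qed simp

text \<open>Both half-line solutions are 1 at the barrier, so gluing them leaves only the equation
  at 0, which is \<open>gap z x = 0\<close>.\<close>

lemma eigenfunction_exists:
  assumes x: "unit_valued x" and z: "z = eigval x"
  obtains U :: "int \<Rightarrow> real" where "U 0 = 1" "\<And>i. \<bar>U i\<bar> \<le> (1 / 2) ^ nat \<bar>i\<bar>"
    "\<And>i. U (i + 1) + U (i - 1) + ((if i = 0 then 100 else x i) - z) * U i = 0"
proof -
  let ?a = "\<lambda>i::nat. x (1 + int i)" and ?b = "\<lambda>i::nat. x (- 1 - int i)"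
  have a: "unit_valued ?a" and b: "unit_valued ?b" using x by (auto simp: unit_valued_def)
  have z98: "z \<ge> 98" and z3: "z > 3" using eigval(1)[OF x] z by auto
  define U where "U = (\<lambda>i::int. if i \<ge> 0 then decaying z ?a (nat i) else decaying z ?b (nat (- i)))"
  have Upos: "U (int k) = decaying z ?a k" and Uneg: "U (- int k) = decaying z ?b k" for k
    by (auto simp: U_def)
  show ?thesis
  proof (rule that[of U])
    show "U 0 = 1" by (simp add: U_def)
    show "\<bar>U i\<bar> \<le> (1 / 2) ^ nat \<bar>i\<bar>" for i
      using decaying_bound[OF z98 a, of "nat i"] decaying_bound[OF z98 b, of "nat (- i)"] by (auto simp: U_def)
    fix i :: int
    consider "i = 0" | k where "i = int (Suc k)" | k where "i = - int (Suc k)"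
      by (metis int_cases2 not0_implies_Suc of_nat_0 minus_zero)
    then show "U (i + 1) + U (i - 1) + ((if i = 0 then 100 else x i) - z) * U i = 0"
    proof cases
      case 1
      have "U 1 + U (- 1) + (100 - z) = 0"
        using Upos[of 1] Uneg[of 1] eigval(2)[OF x] by (simp add: gap_def z)
      then show ?thesis using 1 Upos[of 0] by simp
    next
      case 2
      have i: "i + 1 = int (Suc (Suc k))" "i - 1 = int k" using 2 by auto
      have "(if i = 0 then 100 else x i) = x (1 + int k)" using 2 by simp
      then show ?thesis unfolding i using decaying_recurrence[OF z3 a, of k] by (simp only: 2 Upos)
    next
      case 3
      have i: "i + 1 = - int k" "i - 1 = - int (Suc (Suc k))" using 3 by auto
      have "i \<noteq> 0" "- 1 - int k = i" using 3 by auto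
      then have "(if i = 0 then 100 else x i) = x (- 1 - int k)" by (simp only: if_False)
      then show ?thesis unfolding i using decaying_recurrence[OF z3 b, of k] by (simp only: 3 Uneg add.commute)
    qed
  qed
qed

lemma eigenfunction_quasimode:
  fixes V :: "int \<Rightarrow> real"
  assumes x: "x \<in> binary" and z: "z = eigval x" and "\<epsilon> > 0"
    and pattern: "\<And>L :: nat. \<exists>c. V c = 100 \<and> (\<forall>i. 0 < \<bar>i\<bar> \<and> \<bar>i\<bar> \<le> int L \<longrightarrow> V (c + i) = x i) \<and> \<bar>c\<bar> > N + int L"
  shows "\<exists>\<phi>. finite {n. \<phi> n \<noteq> 0} \<and> (\<forall>n. \<bar>n\<bar> \<le> N \<longrightarrow> \<phi> n = 0)
      \<and> l2_norm \<phi> > 0 \<and> l2_norm (jac V (of_real z) \<phi>) \<le> \<epsilon> * l2_norm \<phi>"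
proof -
  have xu: "unit_valued x" by (rule binary_unit_valued[OF x])
  obtain U :: "int \<Rightarrow> real" where U: "U 0 = 1" "\<And>i. \<bar>U i\<bar> \<le> (1 / 2) ^ nat \<bar>i\<bar>"
    "\<And>i. U (i + 1) + U (i - 1) + ((if i = 0 then 100 else x i) - z) * U i = 0"
    using eigenfunction_exists[OF xu z] by blast
  obtain m where m: "(1 / 2 :: real) ^ m < \<epsilon> / 4"
    using real_arch_pow_inv[of "\<epsilon> / 4" "1/2"] \<open>\<epsilon> > 0\<close> by auto
  \<comment> \<open>The errors are values of \<open>U\<close> at distance L or L + 1. L is positive,
    so that each end site of the support has exactly one neighbour cut off.\<close>
  define L where "L = m + 1"
  obtain c where c: "V c = 100" "\<And>i. 0 < \<bar>i\<bar> \<Longrightarrow> \<bar>i\<bar> \<le> int L \<Longrightarrow> V (c + i) = x i" "\<bar>c\<bar> > N + int L"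
    using pattern[of L] by blast
  have Vc: "V (c + i) = (if i = 0 then 100 else x i)" if "\<bar>i\<bar> \<le> int L" for i
    using c(1) c(2)[of i] that by auto
  define \<phi> where "\<phi> = (\<lambda>n. if \<bar>n - c\<bar> \<le> int L then complex_of_real (U (n - c)) else 0)"
  have supp: "finite {n. \<phi> n \<noteq> 0}"
    by (rule finite_subset[of _ "{c - int L..c + int L}"]) (auto simp: \<phi>_def abs_le_iff)
  have jac_int: "jac V (of_real z) \<phi> n = 0" if n: "\<bar>n - c\<bar> < int L" for n
  proof -
    let ?i = "n - c"
    have "\<phi> n = of_real (U ?i)" "\<phi> (n + 1) = of_real (U (?i + 1))" "\<phi> (n - 1) = of_real (U (?i - 1))"
      using n by (auto simp: \<phi>_def algebra_simps)
    moreover have "V n = (if ?i = 0 then 100 else x ?i)" using Vc[of ?i] n by simp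
    ultimately have "jac V (of_real z) \<phi> n = of_real (U (?i + 1) + U (?i - 1) + ((if ?i = 0 then 100 else x ?i) - z) * U ?i)"
      by (simp add: jac_def)
    then show ?thesis by (simp only: U(3) of_real_0)
  qed
  have jac_edge: "cmod (jac V (of_real z) \<phi> n) \<le> (1 / 2) ^ m" if n: "\<bar>n - c\<bar> = int L \<or> \<bar>n - c\<bar> = int L + 1" for n
  proof -
    let ?i = "n - c"
    have Usmall: "\<bar>U i\<bar> \<le> (1 / 2) ^ m" if "nat \<bar>i\<bar> \<ge> m" for i
      using U(2)[of i] power_decreasing[OF that, of "1 / 2 :: real"] by linarith
    \<comment> \<open>At an end site the equation for \<open>U\<close> turns the residual into minus
      the value cut off; one site further out the residual is the last value kept.\<close>
    have "\<exists>i. nat \<bar>i\<bar> \<ge> m \<and> cmod (jac V (of_real z) \<phi> n) = \<bar>U i\<bar>"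
    proof (cases "\<bar>?i\<bar> = int L")
      case True
      have V: "V n = (if ?i = 0 then 100 else x ?i)" using Vc[of ?i] True by simp
      show ?thesis
      proof (cases "?i > 0")
        case True
        with \<open>\<bar>?i\<bar> = int L\<close> have "\<phi> n = of_real (U ?i)" "\<phi> (n + 1) = 0" "\<phi> (n - 1) = of_real (U (?i - 1))"
          by (auto simp: \<phi>_def L_def algebra_simps)
        then have "jac V (of_real z) \<phi> n = of_real (U (?i - 1) + ((if ?i = 0 then 100 else x ?i) - z) * U ?i)"
          unfolding jac_def V by simp
        also have "\<dots> = of_real (- U (?i + 1))" using U(3)[of ?i] by (intro arg_cong[of _ _ of_real]) linarith
        finally show ?thesis using \<open>\<bar>?i\<bar> = int L\<close> True
          by (intro exI[of _ "?i + 1"]) (auto simp: L_def simp del: of_real_minus)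
      next
        case False
        with \<open>\<bar>?i\<bar> = int L\<close> have "\<phi> n = of_real (U ?i)" "\<phi> (n - 1) = 0" "\<phi> (n + 1) = of_real (U (?i + 1))"
          by (auto simp: \<phi>_def L_def algebra_simps)
        then have "jac V (of_real z) \<phi> n = of_real (U (?i + 1) + ((if ?i = 0 then 100 else x ?i) - z) * U ?i)"
          unfolding jac_def V by simp
        also have "\<dots> = of_real (- U (?i - 1))" using U(3)[of ?i] by (intro arg_cong[of _ _ of_real]) linarith
        finally show ?thesis using \<open>\<bar>?i\<bar> = int L\<close> False
          by (intro exI[of _ "?i - 1"]) (auto simp: L_def simp del: of_real_minus)
      qed
    next
      case False
      with n have i: "\<bar>?i\<bar> = int L + 1" by simp
      show ?thesis
      proof (cases "?i > 0")
        case True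
        with i have "\<phi> n = 0" "\<phi> (n + 1) = 0" "\<phi> (n - 1) = of_real (U (?i - 1))"
          by (auto simp: \<phi>_def algebra_simps)
        then show ?thesis using i True by (intro exI[of _ "?i - 1"]) (auto simp: jac_def L_def)
      next
        case False
        with i have "\<phi> n = 0" "\<phi> (n - 1) = 0" "\<phi> (n + 1) = of_real (U (?i + 1))"
          by (auto simp: \<phi>_def algebra_simps)
        then show ?thesis using i False by (intro exI[of _ "?i + 1"]) (auto simp: jac_def L_def)
      qed
    qed
    then show ?thesis using Usmall by metis
  qed
  have jac_out: "jac V (of_real z) \<phi> n = 0" if "\<bar>n - c\<bar> > int L + 1" for n
  proof -
    have "\<phi> n = 0" "\<phi> (n + 1) = 0" "\<phi> (n - 1) = 0" using that by (auto simp: \<phi>_def)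
    then show ?thesis by (simp add: jac_def)
  qed
  have "l2_norm (jac V (of_real z) \<phi>) \<le> 4 * (1 / 2) ^ m"
  proof (rule l2_norm_le_of_four_sites[of "c - int L - 1" "c - int L" "c + int L" "c + int L + 1"])
    show "jac V (of_real z) \<phi> n = 0" if "n \<notin> {c - int L - 1, c - int L, c + int L, c + int L + 1}" for n
    proof -
      have "\<bar>n - c\<bar> < int L \<or> \<bar>n - c\<bar> > int L + 1" using that by auto
      then show ?thesis using jac_int jac_out by blast
    qed
    show "cmod (jac V (of_real z) \<phi> n) \<le> (1 / 2) ^ m" for n
    proof -
      consider "\<bar>n - c\<bar> < int L" | "\<bar>n - c\<bar> = int L \<or> \<bar>n - c\<bar> = int L + 1" | "\<bar>n - c\<bar> > int L + 1" by linarith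
      then show ?thesis by cases (auto simp: jac_int jac_out jac_edge)
    qed
  qed auto
  moreover have "1 \<le> l2_norm \<phi>"
    using cmod_le_l2_norm[OF finite_support_l2[OF supp], of c] by (simp add: \<phi>_def U(1))
  moreover have "\<phi> n = 0" if "\<bar>n\<bar> \<le> N" for n
    using that c(3) by (auto simp: \<phi>_def)
  ultimately show ?thesis
  proof (intro exI[of _ \<phi>] conjI)
    assume jle: "l2_norm (jac V (of_real z) \<phi>) \<le> 4 * (1 / 2) ^ m" and ge: "1 \<le> l2_norm \<phi>"
    have "4 * (1 / 2) ^ m \<le> \<epsilon> * 1" using m by simp
    also have "\<dots> \<le> \<epsilon> * l2_norm \<phi>" using ge \<open>\<epsilon> > 0\<close> by (intro mult_left_mono) auto
    finally show "l2_norm (jac V (of_real z) \<phi>) \<le> \<epsilon> * l2_norm \<phi>" using jle by linarith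
  qed (use supp in auto)
qed

text \<open>The deterministic core: \<open>intervals\<close> and \<open>patterns\<close> produce the
  spectrum on the right, \<open>sparse\<close> excludes any further spectrum above 3.\<close>

lemma essential_spectrum_sparse_barriers:
  fixes V :: "int \<Rightarrow> real"
  assumes V: "\<And>n. V n = 0 \<or> V n = 1 \<or> V n = 100"
    and sparse: "\<And>L :: nat. \<exists>N\<ge>0. \<forall>i j. V i = 100 \<longrightarrow> V j = 100 \<longrightarrow> \<bar>i\<bar> > N \<longrightarrow> \<bar>j\<bar> > N \<longrightarrow> i \<noteq> j \<longrightarrow> int L \<le> \<bar>i - j\<bar>"
    and intervals: "\<And>c N (L :: nat). c \<in> {0, 1} \<Longrightarrow> \<exists>p. \<forall>n. p \<le> n \<and> n < p + int L \<longrightarrow> V n = c \<and> \<bar>n\<bar> > N"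
    and patterns: "\<And>x N (L :: nat). x \<in> binary \<Longrightarrow>
      \<exists>c. V c = 100 \<and> (\<forall>i. 0 < \<bar>i\<bar> \<and> \<bar>i\<bar> \<le> int L \<longrightarrow> V (c + i) = x i) \<and> \<bar>c\<bar> > N + int L"
  shows "essential_spectrum (schrodinger V) = complex_of_real ` ({-2..3} \<union> eigval ` binary)"
proof (intro equalityI subsetI)
  have K: "\<bar>V n\<bar> \<le> 100" for n using V[of n] by auto
  {
    fix z assume "z \<in> complex_of_real ` ({-2..3} \<union> eigval ` binary)"
    then obtain x where x: "z = of_real x" "x \<in> {-2..3} \<union> eigval ` binary" by blast
    then consider "\<bar>x - 0\<bar> \<le> 2" | "\<bar>x - 1\<bar> \<le> 2" | y where "y \<in> binary" "x = eigval y" by fastforce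
    then have "\<not> l2_fredholm (\<lambda>u. schrodinger V u - (\<lambda>n. z * u n))"
    proof cases
      case 1
      show ?thesis unfolding x(1)
        by (rule not_fredholm_of_quasimodes[OF K], rule plane_wave_quasimode[OF 1]) (use intervals[of 0] in auto)
    next
      case 2
      show ?thesis unfolding x(1)
        by (rule not_fredholm_of_quasimodes[OF K], rule plane_wave_quasimode[OF 2]) (use intervals[of 1] in auto)
    next
      case 3
      show ?thesis unfolding x(1)
        by (rule not_fredholm_of_quasimodes[OF K], rule eigenfunction_quasimode[OF 3]) (use patterns[OF 3(1)] in auto)
    qed
    then show "z \<in> essential_spectrum (schrodinger V)" by (simp add: essential_spectrum_def)
  next
    fix z assume ess: "z \<in> essential_spectrum (schrodinger V)"
    show "z \<in> complex_of_real ` ({-2..3} \<union> eigval ` binary)"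
    proof (rule ccontr)
      assume z: "z \<notin> complex_of_real ` ({-2..3} \<union> eigval ` binary)"
      have "\<exists>c>0. \<exists>N\<ge>0. \<forall>u\<in>l2. (\<forall>n. \<bar>n\<bar> \<le> N \<longrightarrow> u n = 0) \<longrightarrow> c * l2_norm u \<le> l2_norm (jac V z u)"
      proof (cases "Im z = 0")
        case False
        then show ?thesis using lower_bound_nonreal[OF K, of _ z]
          by (intro exI[of _ "\<bar>Im z\<bar>"] conjI exI[of _ 0]) auto
      next
        case True
        then have zx: "z = of_real (Re z)" by (simp add: complex_eq_iff)
        with z have x: "Re z \<notin> {-2..3} \<union> eigval ` binary" by (metis imageI)
        show ?thesis
        proof (cases "Re z > 3")
          case True
          have "\<exists>c>0. \<exists>N\<ge>0. \<forall>u\<in>l2. (\<forall>n. \<bar>n\<bar> \<le> N \<longrightarrow> u n = 0) \<longrightarrow> c * l2_norm u \<le> l2_norm (jac V (of_real (Re z)) u)"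
            by (rule lower_bound_above[OF True _ V sparse]) (use x in auto)
          then show ?thesis using zx by simp
        next
          case False
          with x have "Re z < - 2" by auto
          moreover have V0: "0 \<le> V n \<and> V n \<le> 100" for n using V[of n] by auto
          ultimately show ?thesis using lower_bound_below[OF V0, of _ "Re z"] zx
            by (intro exI[of _ "- Re z - 2"] conjI exI[of _ 0]) auto
        qed
      qed
      then have "l2_fredholm (\<lambda>u. schrodinger V u - (\<lambda>n. z * u n))"
        using fredholm_of_lower_bound[OF K] by meson
      then show False using ess by (simp add: essential_spectrum_def)
    qed
  }
qed

subsection \<open>Patterns in random potentials\<close>

text \<open>Disjoint blocks are independent, and by the uniform bound \<open>m\<close> on their size
  each fails with probability at most 1 - (1/2)^m. The first k of them all fail with probability at
  most the k-th power, which tends to 0.\<close>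

lemma (in prob_space) AE_exists_realised_block:
  fixes J :: "nat \<Rightarrow> 'i set" and t :: "nat \<Rightarrow> 'i \<Rightarrow> real"
  assumes indep: "indep_vars (\<lambda>_. borel) V UNIV"
    and fin: "\<And>j. finite (J j)" and card: "\<And>j. card (J j) \<le> m" and disj: "disjoint_family J"
    and half: "\<And>j i. i \<in> J j \<Longrightarrow> prob {\<omega> \<in> space M. V i \<omega> = t j i} = 1 / 2"
  shows "AE \<omega> in M. \<exists>j. \<forall>i\<in>J j. V i \<omega> = t j i"
proof -
  have meas: "random_variable borel (V i)" for i using indep by (auto simp: indep_vars_def)
  let ?N = "\<lambda>j. PiM (J j) (\<lambda>_. borel :: real measure)"
  let ?X = "\<lambda>j \<omega>. restrict (\<lambda>i. V i \<omega>) (J j)"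
  let ?S = "\<lambda>j. PiE (J j) (\<lambda>i. {t j i})"
  have blocks: "indep_vars ?N ?X UNIV"
    by (rule indep_vars_restrict[OF indep]) (use disj in auto)
  have S: "?S j \<in> sets (?N j)" for j by (rule sets_PiM_I_finite) (use fin in auto)
  define bad where "bad = (\<lambda>j. ?X j -` (space (?N j) - ?S j) \<inter> space M)"
  have bad_iff: "\<omega> \<in> bad j \<longleftrightarrow> \<omega> \<in> space M \<and> \<not> (\<forall>i\<in>J j. V i \<omega> = t j i)" for \<omega> j
    by (auto simp: bad_def space_PiM PiE_def extensional_def Pi_def)
  have bad_sets: "bad j \<in> events" for j
    unfolding bad_def using blocks S by (auto simp: indep_vars_def intro!: measurable_sets)
  have prob_bad: "prob (bad j) \<le> 1 - (1 / 2) ^ m" for j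
  proof -
    let ?G = "{\<omega> \<in> space M. \<forall>i\<in>J j. V i \<omega> = t j i}"
    have G: "?G \<in> events" using meas fin by measurable
    have "prob ?G = (1 / 2) ^ card (J j)"
    proof (cases "J j = {}")
      case True
      then show ?thesis by (simp add: prob_space)
    next
      case False
      have "?G = (\<Inter>i\<in>J j. V i -` {t j i} \<inter> space M)" using False by auto
      then have "prob ?G = (\<Prod>i\<in>J j. prob (V i -` {t j i} \<inter> space M))"
        using indep_varsD[OF indep False fin, of "\<lambda>i. {t j i}"] by simp
      also have "\<dots> = (\<Prod>i\<in>J j. 1 / 2)"
      proof (rule prod.cong[OF refl])
        fix i assume "i \<in> J j"
        moreover have "V i -` {t j i} \<inter> space M = {\<omega> \<in> space M. V i \<omega> = t j i}" by auto
        ultimately show "prob (V i -` {t j i} \<inter> space M) = 1 / 2" using half by simp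
      qed
      finally show ?thesis by simp
    qed
    moreover have "(1 / 2 :: real) ^ m \<le> (1 / 2) ^ card (J j)" using card by (intro power_decreasing) auto
    moreover have "bad j = space M - ?G" using bad_iff by auto
    ultimately show ?thesis using prob_compl[OF G] by simp
  qed
  have all_bad: "prob (\<Inter>j\<in>{..<k}. bad j) \<le> (1 - (1 / 2) ^ m) ^ k" if "k > 0" for k
  proof -
    have "prob (\<Inter>j\<in>{..<k}. bad j) = (\<Prod>j<k. prob (bad j))"
      unfolding bad_def by (rule indep_varsD[OF blocks]) (use that S in auto)
    also have "\<dots> \<le> (\<Prod>j<k. 1 - (1 / 2) ^ m)" by (rule prod_mono) (use prob_bad in auto)
    finally show ?thesis by simp
  qed
  let ?B = "\<Inter>j. bad j"
  have B: "?B \<in> events" using bad_sets by auto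
  have "prob ?B \<le> 0"
  proof (rule LIMSEQ_le_const)
    show "(\<lambda>k. (1 - (1 / 2 :: real) ^ m) ^ k) \<longlonglongrightarrow> 0"
      by (rule LIMSEQ_realpow_zero) (auto simp: power_le_one)
    have "prob ?B \<le> (1 - (1 / 2) ^ m) ^ k" if "k \<ge> 1" for k
    proof -
      have "prob ?B \<le> prob (\<Inter>j\<in>{..<k}. bad j)"
        using that bad_sets by (intro finite_measure_mono sets.finite_INT) (auto simp: lessThan_empty_iff)
      then show ?thesis using all_bad[of k] that by simp
    qed
    then show "\<exists>K. \<forall>k\<ge>K. prob ?B \<le> (1 - (1 / 2) ^ m) ^ k" by blast
  qed
  then have "prob ?B = 0" using measure_nonneg[of M ?B] by linarith
  then have "?B \<in> null_sets M" using B by (simp add: null_sets_def emeasure_eq_measure)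
  then show ?thesis
    by (rule AE_I') (auto simp: bad_iff)
qed

lemma (in prob_space) AE_two_values:
  assumes "random_variable borel X" "a \<noteq> (b :: real)"
    "prob {\<omega> \<in> space M. X \<omega> = a} = 1 / 2" "prob {\<omega> \<in> space M. X \<omega> = b} = 1 / 2"
  shows "AE \<omega> in M. X \<omega> = a \<or> X \<omega> = b"
proof -
  have m: "{\<omega> \<in> space M. X \<omega> = a} \<in> events" "{\<omega> \<in> space M. X \<omega> = b} \<in> events"
    using assms(1) by measurable
  have "prob ({\<omega> \<in> space M. X \<omega> = a} \<union> {\<omega> \<in> space M. X \<omega> = b}) = 1"
    using finite_measure_Union[OF m] assms by fastforce
  then have "AE \<omega> in M. \<omega> \<in> {\<omega> \<in> space M. X \<omega> = a} \<union> {\<omega> \<in> space M. X \<omega> = b}"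
    using m prob_eq_1[of "{\<omega> \<in> space M. X \<omega> = a} \<union> {\<omega> \<in> space M. X \<omega> = b}"] by auto
  then show ?thesis by eventually_elim auto
qed

section \<open>Spacing of the barrier sites\<close>

lemma gaps_eventually:
  fixes n :: "nat \<Rightarrow> int"
  assumes gaps: "filterlim (\<lambda>k. n (Suc k) - n k) at_top sequentially"
  obtains K where "\<And>k l. K \<le> k \<Longrightarrow> k < l \<Longrightarrow> n k + int D \<le> n l"
proof -
  have "\<exists>K. \<forall>k\<ge>K. int D \<le> n (Suc k) - n k"
    using gaps by (simp add: filterlim_at_top eventually_sequentially)
  then obtain K where K: "\<And>k. K \<le> k \<Longrightarrow> int D \<le> n (Suc k) - n k" by blast
  have "n k + int D \<le> n (Suc (k + d))" if "K \<le> k" for k d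
  proof (induction d)
    case 0
    then show ?case using K[OF that] by simp
  next
    case (Suc d)
    then show ?case using K[of "Suc (k + d)"] that by simp
  qed
  then have "n k + int D \<le> n l" if "K \<le> k" "k < l" for k l
    using that less_imp_Suc_add[OF that(2)] by blast
  then show ?thesis using that by blast
qed

lemma sparse_range:
  fixes n :: "nat \<Rightarrow> int"
  assumes gaps: "filterlim (\<lambda>k. n (Suc k) - n k) at_top sequentially"
  shows "\<exists>N\<ge>0. \<forall>i\<in>range n. \<forall>j\<in>range n. \<bar>i\<bar> > N \<longrightarrow> \<bar>j\<bar> > N \<longrightarrow> i \<noteq> j \<longrightarrow> int D \<le> \<bar>i - j\<bar>"
proof -
  obtain K where K: "\<And>k l. K \<le> k \<Longrightarrow> k < l \<Longrightarrow> n k + int D \<le> n l" using gaps_eventually[OF gaps] by blast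
  \<comment> \<open>The early terms, for which the spacing is not yet known, are bounded by this
    sum, so a term of larger modulus has index at least \<open>K\<close>.\<close>
  define N where "N = (\<Sum>k<K. \<bar>n k\<bar>)"
  have large: "K \<le> k" if "\<bar>n k\<bar> > N" for k
  proof (rule ccontr)
    assume "\<not> K \<le> k"
    then have "\<bar>n k\<bar> \<le> N" unfolding N_def by (intro member_le_sum) auto
    then show False using that by simp
  qed
  have "int D \<le> \<bar>n k - n l\<bar>" if "\<bar>n k\<bar> > N" "\<bar>n l\<bar> > N" "n k \<noteq> n l" for k l
    using K[OF large[OF that(1)], of l] K[OF large[OF that(2)], of k] that(3) by (cases k l rule: linorder_cases) auto
  moreover have "N \<ge> 0" unfolding N_def by (rule sum_nonneg) auto
  ultimately show ?thesis by (intro exI[of _ N]) auto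
qed

theorem propositionA1:
  fixes M :: "'w measure"
    and n :: "nat \<Rightarrow> int"
    and V :: "int \<Rightarrow> 'w \<Rightarrow> real"
  assumes "prob_space M"
    and "filterlim n at_top sequentially"
    and "filterlim (\<lambda>k. n (Suc k) - n k) at_top sequentially"
    and "prob_space.indep_vars M (\<lambda>_. borel) V UNIV"
    and "\<And>j. j \<notin> range n \<Longrightarrow>
           measure M {\<omega> \<in> space M. V j \<omega> = 0} = 1 / 2 \<and>
           measure M {\<omega> \<in> space M. V j \<omega> = 1} = 1 / 2"
    and "\<And>j. j \<in> range n \<Longrightarrow>
           measure M {\<omega> \<in> space M. V j \<omega> = 0} = 1 / 2 \<and>
           measure M {\<omega> \<in> space M. V j \<omega> = 100} = 1 / 2"
  shows "\<exists>C. cantor_set C \<and> C \<subseteq> {98..102} \<and>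
           as_essential_spectrum M (\<lambda>\<omega>. schrodinger (\<lambda>j. V j \<omega>))
             (complex_of_real ` ({-2..3} \<union> C))"
proof (intro exI conjI)
  interpret prob_space M by fact
  note indep = assms(4)
  have meas: "random_variable borel (V j)" for j using indep by (auto simp: indep_vars_def)
  show "cantor_set (eigval ` binary)" by (rule cantor_set_eigval_image)
  show "eigval ` binary \<subseteq> {98..102}" using eigval(1) binary_unit_valued by blast
  have "AE \<omega> in M. (j \<notin> range n \<longrightarrow> V j \<omega> = 0 \<or> V j \<omega> = 1) \<and> (j \<in> range n \<longrightarrow> V j \<omega> = 0 \<or> V j \<omega> = 100)" for j
  proof (cases "j \<in> range n")
    case True
    then show ?thesis using AE_two_values[OF meas, of 0 100 j] assms(6)[of j] by simp
  next
    case False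
    then show ?thesis using AE_two_values[OF meas, of 0 1 j] assms(5)[of j] by simp
  qed
  then have two_vals: "AE \<omega> in M. \<forall>j. (j \<notin> range n \<longrightarrow> V j \<omega> = 0 \<or> V j \<omega> = 1) \<and> (j \<in> range n \<longrightarrow> V j \<omega> = 0 \<or> V j \<omega> = 100)"
    by (simp add: AE_all_countable)
  have "\<exists>K0. \<forall>k\<ge>K0. 0 \<le> n k" using assms(2) by (simp add: filterlim_at_top eventually_sequentially)
  then obtain K0 where K0: "\<And>k. k \<ge> K0 \<Longrightarrow> 0 \<le> n k" by blast
  \<comment> \<open>A lower bound - m for the whole sequence leaves the half-line to its left free
    of barrier sites; the constant stretches are found there.\<close>
  define m where "m = (\<Sum>k<K0. \<bar>n k\<bar>)"
  have n_low: "- m \<le> n k" for k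
  proof (cases "k < K0")
    case True
    then have "\<bar>n k\<bar> \<le> m" unfolding m_def by (intro member_le_sum) auto
    then show ?thesis by simp
  next
    case False
    moreover have "0 \<le> m" unfolding m_def by (rule sum_nonneg) auto
    ultimately show ?thesis using K0[of k] by simp
  qed
  have "AE \<omega> in M. \<exists>p. \<forall>i. p \<le> i \<and> i < p + int L \<longrightarrow> V i \<omega> = c \<and> \<bar>i\<bar> > int N"
    if c: "c \<in> {0, 1}" for c :: real and N L :: nat
  proof -
    \<comment> \<open>Consecutive blocks of length \<open>L\<close> marching to the left, all beyond
      both - m and - N.\<close>
    define start where "start = (\<lambda>j::nat. - m - int N - (int j + 1) * int L)"
    define J where "J = (\<lambda>j. {start j..<start j + int L})"
    have J_low: "i < - m - int N" if "i \<in> J j" for i j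
    proof -
      have "start j + int L \<le> - m - int N" by (simp add: start_def algebra_simps)
      then show ?thesis using that by (simp add: J_def)
    qed
    have "J j \<inter> J k = {}" if "j < k" for j k
    proof -
      have "(int j + 1) * int L + int L \<le> (int k + 1) * int L"
        using that mult_right_mono[of "int j + 2" "int k + 1" "int L"] by (simp add: algebra_simps)
      then show ?thesis by (auto simp: J_def start_def)
    qed
    then have disj: "disjoint_family J"
      unfolding disjoint_family_on_def by (metis Int_commute linorder_neqE_nat)
    have "AE \<omega> in M. \<exists>j. \<forall>i\<in>J j. V i \<omega> = c"
    proof (rule AE_exists_realised_block[OF indep, of J L])
      show "prob {\<omega> \<in> space M. V i \<omega> = c} = 1 / 2" if "i \<in> J j" for i j
      proof -
        have "i < - m" using J_low[OF that] by simp
        then have "i \<notin> range n" using n_low by (auto simp: not_le[symmetric])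
        then show ?thesis using assms(5)[of i] c by auto
      qed
    qed (use disj in \<open>auto simp: J_def\<close>)
    then show ?thesis
    proof eventually_elim
      case (elim \<omega>)
      then obtain j where j: "\<And>i. i \<in> J j \<Longrightarrow> V i \<omega> = c" by blast
      have "0 \<le> m" unfolding m_def by (rule sum_nonneg) auto
      then show ?case using j J_low[of _ j]
        by (intro exI[of _ "start j"]) (force simp: J_def)
    qed
  qed
  then have intervals: "AE \<omega> in M. \<forall>c\<in>{0, 1}. \<forall>N L :: nat. \<exists>p. \<forall>i. p \<le> i \<and> i < p + int L \<longrightarrow> V i \<omega> = c \<and> \<bar>i\<bar> > int N"
    by (simp add: AE_all_countable)
  \<comment> \<open>A pattern is given as the indicator of \<open>S\<close>. As
    \<open>binary\<close> is uncountable, the exceptional null sets are later united over finite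
    \<open>S\<close> only, which represent every pattern on a window of radius
    \<open>L\<close>.\<close>
  have "AE \<omega> in M. \<exists>c. V c \<omega> = 100 \<and> (\<forall>i. 0 < \<bar>i\<bar> \<and> \<bar>i\<bar> \<le> int L \<longrightarrow> V (c + i) \<omega> = of_bool (i \<in> S)) \<and> \<bar>c\<bar> > int N + int L"
    for S :: "int set" and N L :: nat
  proof -
    \<comment> \<open>A spacing of 2 * L + 1 keeps windows of radius \<open>L\<close> around barrier
      sites disjoint and free of other barrier sites. Beyond \<open>K2\<close> the centres exceed
      \<open>N0\<close> by more than \<open>L\<close>, so the spacing applies throughout each
      window.\<close>
    obtain N0 where N0: "\<And>i j. i \<in> range n \<Longrightarrow> j \<in> range n \<Longrightarrow> \<bar>i\<bar> > N0 \<Longrightarrow> \<bar>j\<bar> > N0 \<Longrightarrow> i \<noteq> j \<Longrightarrow> int (2 * L + 1) \<le> \<bar>i - j\<bar>"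
      using sparse_range[OF assms(3), of "2 * L + 1"] by metis
    obtain K1 where K1: "\<And>k l. K1 \<le> k \<Longrightarrow> k < l \<Longrightarrow> n k + int (2 * L + 1) \<le> n l"
      using gaps_eventually[OF assms(3), of "2 * L + 1"] by metis
    have "\<exists>K2. \<forall>k\<ge>K2. \<bar>N0\<bar> + int N + int L + 1 \<le> n k"
      using assms(2) by (simp add: filterlim_at_top eventually_sequentially)
    then obtain K2 where K2: "\<And>k. k \<ge> K2 \<Longrightarrow> \<bar>N0\<bar> + int N + int L + 1 \<le> n k" by blast
    define c where "c = (\<lambda>j. n (max K1 K2 + j))"
    have c_large: "\<bar>N0\<bar> + int N + int L + 1 \<le> c j" for j unfolding c_def by (rule K2) simp
    define J where "J = (\<lambda>j. {c j - int L..c j + int L})"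
    define t where "t = (\<lambda>j i. if i = c j then 100 else of_bool (i - c j \<in> S) :: real)"
    have "J j \<inter> J k = {}" if "j < k" for j k
    proof -
      have "c j + int (2 * L + 1) \<le> c k" unfolding c_def by (rule K1) (use that in auto)
      then show ?thesis by (auto simp: J_def)
    qed
    then have disj: "disjoint_family J"
      unfolding disjoint_family_on_def by (metis Int_commute linorder_neqE_nat)
    have "AE \<omega> in M. \<exists>j. \<forall>i\<in>J j. V i \<omega> = t j i"
    proof (rule AE_exists_realised_block[OF indep, of J "2 * L + 1"])
      show "prob {\<omega> \<in> space M. V i \<omega> = t j i} = 1 / 2" if i: "i \<in> J j" for i j
      proof (cases "i = c j")
        case True
        then have "i \<in> range n" by (simp add: c_def)
        then show ?thesis using assms(6)[of i] True by (simp add: t_def)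
      next
        case False
        have "i \<notin> range n"
        proof
          assume "i \<in> range n"
          moreover have "\<bar>i\<bar> > N0" "\<bar>c j\<bar> > N0" using i c_large[of j] by (auto simp: J_def)
          ultimately have "int (2 * L + 1) \<le> \<bar>i - c j\<bar>" using N0[of i "c j"] False by (simp add: c_def)
          then show False using i by (auto simp: J_def)
        qed
        then show ?thesis using assms(5)[of i] False by (simp add: t_def)
      qed
    qed (use disj in \<open>auto simp: J_def\<close>)
    then show ?thesis
    proof eventually_elim
      case (elim \<omega>)
      then obtain j where j: "\<And>i. i \<in> J j \<Longrightarrow> V i \<omega> = t j i" by blast
      show ?case
      proof (intro exI[of _ "c j"] conjI allI impI)
        show "V (c j) \<omega> = 100" using j[of "c j"] by (simp add: J_def t_def)
        show "V (c j + i) \<omega> = of_bool (i \<in> S)" if "0 < \<bar>i\<bar> \<and> \<bar>i\<bar> \<le> int L" for i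
        proof -
          have "c j + i \<in> J j" using that by (auto simp: J_def abs_le_iff)
          from j[OF this] that show ?thesis by (simp add: t_def)
        qed
        show "\<bar>c j\<bar> > int N + int L" using c_large[of j] by simp
      qed
    qed
  qed
  then have patterns: "AE \<omega> in M. \<forall>S\<in>{S. finite S}. \<forall>N L :: nat. \<exists>c. V c \<omega> = 100 \<and>
      (\<forall>i. 0 < \<bar>i\<bar> \<and> \<bar>i\<bar> \<le> int L \<longrightarrow> V (c + i) \<omega> = of_bool (i \<in> S)) \<and> \<bar>c\<bar> > int N + int L"
    by (subst AE_ball_countable) (auto simp: AE_all_countable countable_Collect_finite)
  show "as_essential_spectrum M (\<lambda>\<omega>. schrodinger (\<lambda>j. V j \<omega>)) (complex_of_real ` ({-2..3} \<union> eigval ` binary))"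
    unfolding as_essential_spectrum_def
    using two_vals intervals patterns
  proof eventually_elim
    case (elim \<omega>)
    show ?case
    proof (rule essential_spectrum_sparse_barriers)
      show "V j \<omega> = 0 \<or> V j \<omega> = 1 \<or> V j \<omega> = 100" for j using elim(1) by blast
      have barrier: "j \<in> range n" if "V j \<omega> = 100" for j
        using elim(1) that by (metis zero_neq_numeral one_eq_numeral_iff semiring_norm(83))
      show "\<exists>N\<ge>0. \<forall>i j. V i \<omega> = 100 \<longrightarrow> V j \<omega> = 100 \<longrightarrow> \<bar>i\<bar> > N \<longrightarrow> \<bar>j\<bar> > N \<longrightarrow> i \<noteq> j \<longrightarrow> int L \<le> \<bar>i - j\<bar>" for L
        using sparse_range[OF assms(3), of L] barrier by meson
      show "\<exists>p. \<forall>i. p \<le> i \<and> i < p + int L \<longrightarrow> V i \<omega> = c \<and> \<bar>i\<bar> > N" if "c \<in> {0, 1}" for c N and L :: nat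
      proof -
        have "N \<le> int (nat N)" by simp
        moreover have "\<exists>p. \<forall>i. p \<le> i \<and> i < p + int L \<longrightarrow> V i \<omega> = c \<and> \<bar>i\<bar> > int (nat N)"
          by (rule bspec[OF elim(2) that, THEN spec, THEN spec])
        ultimately show ?thesis by (meson le_less_trans)
      qed
      show "\<exists>c. V c \<omega> = 100 \<and> (\<forall>i. 0 < \<bar>i\<bar> \<and> \<bar>i\<bar> \<le> int L \<longrightarrow> V (c + i) \<omega> = x i) \<and> \<bar>c\<bar> > N + int L"
        if x: "x \<in> binary" for x N and L :: nat
      proof -
        define S where "S = {i \<in> {- int L..int L}. x i = 1}"
        have xS: "of_bool (i \<in> S) = x i" if "\<bar>i\<bar> \<le> int L" for i
          using x that by (auto simp: S_def binary_iff abs_le_iff)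
        have "finite S" unfolding S_def by (rule finite_subset[of _ "{- int L..int L}"]) auto
        then have S: "S \<in> {S. finite S}" by (rule CollectI)
        obtain c where c: "V c \<omega> = 100 \<and> (\<forall>i. 0 < \<bar>i\<bar> \<and> \<bar>i\<bar> \<le> int L \<longrightarrow> V (c + i) \<omega> = of_bool (i \<in> S))
            \<and> \<bar>c\<bar> > int (nat N) + int L"
          using spec[OF spec[OF bspec[OF elim(3) S], of "nat N"], of L] by (rule exE)
        have "V (c + i) \<omega> = x i" if "0 < \<bar>i\<bar> \<and> \<bar>i\<bar> \<le> int L" for i
          using c xS[of i] that by metis
        moreover have "\<bar>c\<bar> > N + int L" using c by linarith
        ultimately show ?thesis using c by blast
      qed
    qed
  qed
qed

end
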